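(* Let $\bm{x}(t)$ be the solution of the stochastic differential equation $$d\bm{x}(t) = -\bm{L}\bm{x}(t)\,dt + \alpha\, d\bm{b}(t),\qquad \bm{x}(0)=\bm{c},$$ where $\bm{c}=(c_1,\dots,c_n)^T\in\mathbb{R}^n$ is a fixed vector, $\alpha>0$, $\bm{b}(t)$ is the $n$-dimensional standard Wiener process, and $\bm{L}$ is the weighted Laplacian matrix of a connected undirected graph. Let $\gamma = \frac1n\sum_{i=1}^n c_i$ and let $\bm{e}(t)=\bm{x}(t)-\gamma\bm{1}$ be the residual error, with mean vector $\bm{\mu}(t)$ and covariance matrix $\bm{\Sigma}(t)$. Then for every real $t>0$, $$\bm{\mu}(t) = \exp(-\bm{L}t)(\bm{c}-\gamma\bm{1}),$$ $$\bm{\Sigma}(t) = \bm{U}\,\mathrm{diag}\left(\alpha^2 t,\theta_2,\theta_3,\dots,\theta_n\right)\bm{U}^T,\qquad \theta_i = \frac{\alpha^2}{2\lambda_i}\left(1-e^{-2\lambda_i t}\right)\quad (i=2,\dots,n).$$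
   Context: $G=(V,E)$ is a connected undirected graph with $V=\{1,\dots,n\}$; $\mathcal{N}_i=\{j\in V: (j,i)\in E,\ j\neq i\}$ is the neighborhood of node $i$. Each edge $(i,j)\in E$ carries a positive weight $\mu_{ij}$ with $\mu_{ij}=\mu_{ji}$. The Laplacian matrix $\bm{L}=\{L_{ij}\}\in\mathbb{R}^{n\times n}$ is defined by $L_{ii}=\sum_{j\in\mathcal{N}_i}\mu_{ij}$, $L_{ij}=-\mu_{ij}$ if $i\neq j$ and $(i,j)\in E$, and $L_{ij}=0$ if $i\ne j$ and $(i,j)\notin E$. It is symmetric positive semidefinite with $\bm{L}\bm{1}=\bm{0}$, where $\bm{1}=(1,\dots,1)^T$. Its eigenvalues are $\lambda_1=0<\lambda_2\le\cdots\le\lambda_n$, with corresponding orthonormal eigenvectors $\bm{\xi}_1=(1/\sqrt n)\bm{1},\bm{\xi}_2,\dots,\bm{\xi}_n$, and $\bm{U}=(\bm{\xi}_1,\dots,\bm{\xi}_n)$, so that $\bm{L}=\bm{U}\,\mathrm{diag}(\lambda_1,\dots,\lambda_n)\,\bm{U}^T$. $\exp$ denotes the matrix exponential and $\mathrm{diag}(\cdot)$ the diagonal matrix with the given diagonal entries. The components of the $n$-dimensional standard Wiener process $\bm{b}(t)$ are independent one-dimensional standard Wiener processes starting at $0$. *)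

theory Defs
  imports "HOL-Probability.Probability"
begin

section \<open>Matrices\<close>

text \<open>The vertices \<open>1, \<dots>, n\<close>, and likewise the indices of the eigenvalues, are the elements of
  a finite linearly ordered type; \<open>Min UNIV\<close> plays the role of the index \<open>1\<close>.
  For this sort the plain form \<open>(real, 'n) vec\<close> is used, since the notation \<open>real^'n\<close> forces
  the sort \<open>finite\<close>.\<close>

definition diag_matrix :: "('n \<Rightarrow> real) \<Rightarrow> real^'n^'n" where
  "diag_matrix d = (\<chi> i j. if i = j then d i else 0)"

definition matrix_of_columns :: "('n \<Rightarrow> real^'n) \<Rightarrow> real^'n^'n" where
  "matrix_of_columns \<xi> = (\<chi> i k. \<xi> k $ i)"

text \<open>The library constants \<open>exp\<close> and \<open>(^)\<close> do not apply: the multiplication of the type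
  \<^typ>\<open>real^'n^'n\<close> is componentwise.\<close>

definition matrix_power :: "real^'n^'n \<Rightarrow> nat \<Rightarrow> real^'n^'n" where
  "matrix_power A k = ((\<lambda>B. A ** B) ^^ k) (mat 1)"

definition matrix_exp :: "real^'n^'n \<Rightarrow> real^'n^'n" where
  "matrix_exp A = (\<Sum>k. (1 / fact k) *\<^sub>R matrix_power A k)"

definition laplacian :: "('n \<times> 'n) set \<Rightarrow> ('n \<Rightarrow> 'n \<Rightarrow> real) \<Rightarrow> real^'n^'n" where
  "laplacian E w = (\<chi> i j.
     if i = j then (\<Sum>k\<in>{k. (k, i) \<in> E \<and> k \<noteq> i}. w i k)
     else if (i, j) \<in> E then - w i j
     else 0)"

definition ordered_orthonormal_eigenbasis ::
    "((real, 'n) vec, 'n) vec \<Rightarrow> ('n::{finite,linorder} \<Rightarrow> real) \<Rightarrow> ('n \<Rightarrow> (real, 'n) vec) \<Rightarrow> bool" where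
  "ordered_orthonormal_eigenbasis A lam \<xi> \<longleftrightarrow>
     (\<forall>i. A *v \<xi> i = lam i *\<^sub>R \<xi> i) \<and>
     (\<forall>i j. \<xi> i \<bullet> \<xi> j = (if i = j then 1 else 0)) \<and>
     mono lam"


section \<open>Wiener processes and stochastic differential equations\<close>

context prob_space
begin

text \<open>Time is \<open>[0, \<infinity>)\<close>; the values of a process at negative times are irrelevant.\<close>

definition wiener_process :: "(real \<Rightarrow> 'a \<Rightarrow> real) \<Rightarrow> bool" where
  "wiener_process W \<longleftrightarrow>
     (\<forall>t\<ge>0. random_variable borel (W t)) \<and>
     (AE \<omega> in M. W 0 \<omega> = 0) \<and>
     (\<forall>s t. 0 \<le> s \<and> s < t \<longrightarrow>
        distributed M lborel (\<lambda>\<omega>. W t \<omega> - W s \<omega>) (normal_density 0 (sqrt (t - s)))) \<and>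
     (\<forall>m (\<tau> :: nat \<Rightarrow> real). 0 \<le> \<tau> 0 \<and> mono_on {..m} \<tau> \<longrightarrow>
        indep_vars (\<lambda>_. borel) (\<lambda>k \<omega>. W (\<tau> (Suc k)) \<omega> - W (\<tau> k) \<omega>) {..<m}) \<and>
     (AE \<omega> in M. continuous_on {0..} (\<lambda>t. W t \<omega>))"

text \<open>The components are independent as processes, that is, as random elements of the path space
  \<open>\<real>\<^bsup>[0,\<infinity>)\<^esup>\<close> with its product sigma-algebra.\<close>

definition vector_wiener_process :: "(real \<Rightarrow> 'a \<Rightarrow> real^'n) \<Rightarrow> bool" where
  "vector_wiener_process b \<longleftrightarrow>
     (\<forall>i. wiener_process (\<lambda>t \<omega>. b t \<omega> $ i)) \<and>
     indep_vars (\<lambda>_. Pi\<^sub>M {0..} (\<lambda>_. borel)) (\<lambda>i \<omega>. \<lambda>t\<in>{0..}. b t \<omega> $ i) UNIV"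

text \<open>\<open>x\<close> solves \<open>dx = f(x) dt + a db\<close>, \<open>x(0) = c\<close>, with a constant diffusion coefficient
  \<open>a\<close>. As usual this means the integral equation
  \<open>x(t) = c + \<integral>\<^sub>0\<^sup>t f(x(s)) ds + \<integral>\<^sub>0\<^sup>t a db(s)\<close>; by the definition of the stochastic integral on
  step integrands, its last term is \<open>a (b(t) - b(0))\<close>. Adaptedness of \<open>x\<close> is not demanded, so
  every strong or weak solution is covered.\<close>

definition solves_additive_noise_sde ::
    "(real^'n \<Rightarrow> real^'n) \<Rightarrow> real \<Rightarrow> (real \<Rightarrow> 'a \<Rightarrow> real^'n) \<Rightarrow> real^'n \<Rightarrow>
     (real \<Rightarrow> 'a \<Rightarrow> real^'n) \<Rightarrow> bool" where
  "solves_additive_noise_sde f a b c x \<longleftrightarrow>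
     (\<forall>t\<ge>0. random_variable borel (x t)) \<and>
     (AE \<omega> in M. continuous_on {0..} (\<lambda>t. x t \<omega>)) \<and>
     (AE \<omega> in M. x 0 \<omega> = c) \<and>
     (AE \<omega> in M. \<forall>t\<ge>0. (\<lambda>s. f (x s \<omega>)) integrable_on {0..t} \<and>
        x t \<omega> = c + integral {0..t} (\<lambda>s. f (x s \<omega>)) + a *\<^sub>R (b t \<omega> - b 0 \<omega>))"


section \<open>Moments of random vectors\<close>

text \<open>The Bochner integral of a non-integrable function is \<open>0\<close>, so statements about
  \<open>mean_vector\<close> and \<open>covariance_matrix\<close> are meaningful only together with
  \<open>has_second_moments\<close>.\<close>

definition has_second_moments :: "('a \<Rightarrow> real^'n) \<Rightarrow> bool" where
  "has_second_moments X \<longleftrightarrow>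
     (\<forall>i. integrable M (\<lambda>\<omega>. X \<omega> $ i) \<and> integrable M (\<lambda>\<omega>. (X \<omega> $ i)\<^sup>2))"

definition mean_vector :: "('a \<Rightarrow> real^'n) \<Rightarrow> real^'n" where
  "mean_vector X = (\<chi> i. expectation (\<lambda>\<omega>. X \<omega> $ i))"

definition covariance_matrix :: "('a \<Rightarrow> real^'n) \<Rightarrow> real^'n^'n" where
  "covariance_matrix X = (\<chi> i j.
     expectation (\<lambda>\<omega>. (X \<omega> $ i - mean_vector X $ i) * (X \<omega> $ j - mean_vector X $ j)))"

end

end

theory Submission
  imports Defs
begin

text \<open>
  In the eigenbasis of the Laplacian the equation decouples. The coordinate \<open>y\<^sub>k = x \<bullet> \<xi>\<^sub>k\<close>
  satisfies \<open>dy\<^sub>k = - \<lambda>\<^sub>k y\<^sub>k dt + \<alpha> dB\<^sub>k\<close>, where \<open>B\<^sub>k\<close> is the coordinate of the noise, and the noise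
  is additive, so the equation can be solved path by path with variation of constants
  (\<open>linear_integral_equation_solution\<close>, \<open>linear_sde_mode\<close>):
  \<open>y\<^sub>k(t) = exp(- \<lambda>\<^sub>k t) y\<^sub>k(0) + \<alpha> \<integral>\<^sub>0\<^sup>t exp(- \<lambda>\<^sub>k (t - s)) dB\<^sub>k(s)\<close>.
  The integrand is smooth, so the last integral is defined through integration by parts and needs no
  stochastic limit.

  The first term, reassembled over \<open>k\<close>, is the matrix exponential applied to the initial value
  (\<open>matrix_exp_mult_eigenbasis\<close>). The noise integrals have mean zero. An orthogonal change of
  coordinates keeps the noise uncorrelated (\<open>uncorrelated_wiener_modes\<close>), so the Ito isometry
  (\<open>ito_isometry\<close>) shows that distinct modes are uncorrelated and that mode \<open>k\<close> has variance
  \<open>\<alpha>\<^sup>2 \<integral>\<^sub>0\<^sup>t exp(- 2 \<lambda>\<^sub>k (t - s)) ds\<close>. This equals \<open>\<alpha>\<^sup>2 t\<close> for \<open>\<lambda>\<^sub>k = 0\<close> and \<open>\<theta>\<^sub>k\<close> otherwise, and connectedness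
  makes the constant mode the only one with eigenvalue \<open>0\<close> (\<open>laplacian_eigenvalue_eq_0_iff\<close>).

  The isometry for smooth integrands follows from Fubini's theorem applied twice, with the
  covariance \<open>min s r\<close> as the only input. Fubini's theorem requires joint measurability in time and
  chance, which almost sure path continuity yields after a change on a null set
  (\<open>continuous_modification\<close>).
\<close>

section \<open>Matrices in an orthonormal eigenbasis\<close>

lemma columns_diag_transpose_nth:
  "(matrix_of_columns \<xi> ** diag_matrix d ** transpose (matrix_of_columns \<xi>)) $ i $ j =
     (\<Sum>k\<in>UNIV. d k * (\<xi> k $ i * \<xi> k $ j))"
proof -
  have "(\<Sum>k\<in>UNIV. \<xi> k $ i * (if k = l then d k else 0)) = d l * \<xi> l $ i" for l
    by (simp add: if_distrib cong: if_cong)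
  then show ?thesis
    by (simp add: matrix_matrix_mult_def transpose_def matrix_of_columns_def diag_matrix_def
        mult.assoc)
qed

text \<open>The hypothesis says that \<open>U\<^sup>T U = 1\<close> for the square matrix \<open>U\<close> with columns \<open>\<xi>\<close>; a left
  inverse of a square matrix is also a right inverse, and the conclusion reads off the entries of
  \<open>U U\<^sup>T = 1\<close>.\<close>
lemma orthonormal_resolution_of_identity:
  fixes \<xi> :: "'n \<Rightarrow> real^'n"
  assumes on: "\<And>i j. \<xi> i \<bullet> \<xi> j = (if i = j then 1 else 0)"
  shows "(\<Sum>k\<in>UNIV. \<xi> k $ i * \<xi> k $ j) = (if i = j then 1 else 0)"
proof -
  let ?U = "matrix_of_columns \<xi>"
  have "transpose ?U ** ?U = mat 1"
    using on by (simp add: vec_eq_iff matrix_matrix_mult_def transpose_def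
        matrix_of_columns_def mat_def inner_vec_def)
  then have "?U ** transpose ?U = mat 1"
    by (simp add: matrix_left_right_inverse)
  then show ?thesis
    by (simp add: vec_eq_iff matrix_matrix_mult_def transpose_def matrix_of_columns_def mat_def)
qed

lemma orthonormal_expansion:
  fixes \<xi> :: "'n \<Rightarrow> real^'n"
  assumes on: "\<And>i j. \<xi> i \<bullet> \<xi> j = (if i = j then 1 else 0)"
  shows "v $ i = (\<Sum>k\<in>UNIV. (v \<bullet> \<xi> k) * \<xi> k $ i)"
proof -
  have "(\<Sum>k\<in>UNIV. (v \<bullet> \<xi> k) * \<xi> k $ i) = (\<Sum>k\<in>UNIV. \<Sum>j\<in>UNIV. v $ j * (\<xi> k $ j * \<xi> k $ i))"
    by (simp add: inner_vec_def sum_distrib_right mult.assoc)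
  also have "\<dots> = (\<Sum>j\<in>UNIV. v $ j * (\<Sum>k\<in>UNIV. \<xi> k $ j * \<xi> k $ i))"
    by (subst sum.swap) (simp add: sum_distrib_left)
  also have "\<dots> = v $ i"
    by (simp add: orthonormal_resolution_of_identity[OF on] if_distrib cong: if_cong)
  finally show ?thesis ..
qed

lemma matrix_power_nth_eigenbasis:
  fixes A :: "real^'n^'n" and \<xi> :: "'n \<Rightarrow> real^'n"
  assumes on: "\<And>i j. \<xi> i \<bullet> \<xi> j = (if i = j then 1 else 0)"
    and ev: "\<And>k. A *v \<xi> k = d k *\<^sub>R \<xi> k"
  shows "matrix_power A m $ i $ j = (\<Sum>k\<in>UNIV. d k ^ m * (\<xi> k $ i * \<xi> k $ j))"
proof (induction m arbitrary: i j)
  case 0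
  then show ?case
    by (simp add: matrix_power_def mat_def orthonormal_resolution_of_identity[OF on])
next
  case (Suc m)
  have "matrix_power A (Suc m) $ i $ j = (\<Sum>l\<in>UNIV. A $ i $ l * matrix_power A m $ l $ j)"
    by (simp add: matrix_power_def matrix_matrix_mult_def)
  also have "\<dots> = (\<Sum>l\<in>UNIV. \<Sum>k\<in>UNIV. A $ i $ l * (d k ^ m * (\<xi> k $ l * \<xi> k $ j)))"
    by (simp add: Suc sum_distrib_left)
  also have "\<dots> = (\<Sum>k\<in>UNIV. d k ^ m * ((A *v \<xi> k) $ i * \<xi> k $ j))"
    by (subst sum.swap)
      (simp add: matrix_vector_mult_def sum_distrib_left sum_distrib_right mult_ac)
  also have "\<dots> = (\<Sum>k\<in>UNIV. d k ^ Suc m * (\<xi> k $ i * \<xi> k $ j))"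
    by (simp add: ev mult_ac)
  finally show ?case .
qed

text \<open>The powers of \<open>A\<close> are diagonal in the eigenbasis, so the exponential series converges entry by
  entry to a combination of scalar exponential series. This also settles its convergence in the
  space of matrices.\<close>
lemma matrix_exp_nth_eigenbasis:
  fixes A :: "real^'n^'n" and \<xi> :: "'n \<Rightarrow> real^'n"
  assumes on: "\<And>i j. \<xi> i \<bullet> \<xi> j = (if i = j then 1 else 0)"
    and ev: "\<And>k. A *v \<xi> k = d k *\<^sub>R \<xi> k"
  shows "matrix_exp A $ i $ j = (\<Sum>k\<in>UNIV. exp (d k) * (\<xi> k $ i * \<xi> k $ j))"
proof -
  let ?S = "(\<chi> i j. \<Sum>k\<in>UNIV. exp (d k) * (\<xi> k $ i * \<xi> k $ j)) :: real^'n^'n"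
  have "(\<lambda>m. (1 / fact m) *\<^sub>R matrix_power A m) sums ?S"
    unfolding sums_def
  proof (intro vec_tendstoI)
    fix i j
    have "(\<lambda>m. \<Sum>k\<in>UNIV. (d k ^ m /\<^sub>R fact m) * (\<xi> k $ i * \<xi> k $ j)) sums
        (\<Sum>k\<in>UNIV. exp (d k) * (\<xi> k $ i * \<xi> k $ j))"
      by (intro sums_sum sums_mult2 exp_converges)
    then show "(\<lambda>n. (\<Sum>m<n. (1 / fact m) *\<^sub>R matrix_power A m) $ i $ j) \<longlonglongrightarrow> ?S $ i $ j"
      by (simp add: sums_def matrix_power_nth_eigenbasis[OF on ev] sum_distrib_left field_simps)
  qed
  then show ?thesis
    by (simp add: matrix_exp_def sums_iff)
qed

lemma matrix_exp_mult_eigenbasis: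
  fixes A :: "real^'n^'n" and \<xi> :: "'n \<Rightarrow> real^'n"
  assumes on: "\<And>i j. \<xi> i \<bullet> \<xi> j = (if i = j then 1 else 0)"
    and ev: "\<And>k. A *v \<xi> k = d k *\<^sub>R \<xi> k"
  shows "(matrix_exp A *v v) $ i = (\<Sum>k\<in>UNIV. exp (d k) * (v \<bullet> \<xi> k) * \<xi> k $ i)"
proof -
  have "(matrix_exp A *v v) $ i =
      (\<Sum>j\<in>UNIV. \<Sum>k\<in>UNIV. exp (d k) * (\<xi> k $ i * \<xi> k $ j) * v $ j)"
    by (simp add: matrix_vector_mult_def matrix_exp_nth_eigenbasis[OF on ev] sum_distrib_right)
  also have "\<dots> = (\<Sum>k\<in>UNIV. exp (d k) * (v \<bullet> \<xi> k) * \<xi> k $ i)"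
    by (subst sum.swap) (simp add: inner_vec_def sum_distrib_left sum_distrib_right mult_ac)
  finally show ?thesis .
qed

section \<open>The kernel of the Laplacian of a connected graph\<close>

lemma laplacian_symmetric:
  assumes "sym E" and "\<And>i j. (i, j) \<in> E \<Longrightarrow> w i j = w j i"
  shows "transpose (laplacian E w) = laplacian E w"
  using assms by (auto simp: vec_eq_iff transpose_def laplacian_def dest: symD)

text \<open>In this form loops contribute nothing, so the sum may run over all neighbours.\<close>
lemma laplacian_mult_nth:
  fixes v :: "real^'n"
  assumes "sym E"
  shows "(laplacian E w *v v) $ i = (\<Sum>j\<in>UNIV. if (i, j) \<in> E then w i j * (v $ i - v $ j) else 0)"
proof -
  have "(laplacian E w *v v) $ i =
     (\<Sum>j\<in>UNIV. (if j = i then (\<Sum>k\<in>{k. (k, i) \<in> E \<and> k \<noteq> i}. w i k) * v $ i else 0) +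
                  (if (i, j) \<in> E \<and> j \<noteq> i then - (w i j * v $ j) else 0))"
    unfolding matrix_vector_mult_def laplacian_def by (auto intro!: sum.cong)
  also have "\<dots> = (\<Sum>k\<in>{k. (k, i) \<in> E \<and> k \<noteq> i}. w i k) * v $ i +
      (\<Sum>j\<in>UNIV. if (i, j) \<in> E \<and> j \<noteq> i then - (w i j * v $ j) else 0)"
    by (simp add: sum.distrib)
  also have "{k. (k, i) \<in> E \<and> k \<noteq> i} = {k. (i, k) \<in> E \<and> k \<noteq> i}"
    using \<open>sym E\<close> by (auto dest: symD)
  also have "(\<Sum>k\<in>{k. (i, k) \<in> E \<and> k \<noteq> i}. w i k) * v $ i =
      (\<Sum>j\<in>UNIV. if (i, j) \<in> E \<and> j \<noteq> i then w i j * v $ i else 0)"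
    by (simp add: sum_distrib_right sum.inter_filter[symmetric])
  finally show ?thesis
    by (simp add: sum.distrib[symmetric])
      (auto intro!: sum.cong simp: algebra_simps)
qed

lemma laplacian_mult_one:
  fixes w :: "'n \<Rightarrow> 'n::finite \<Rightarrow> real"
  assumes "sym E"
  shows "laplacian E w *v 1 = 0"
  using assms by (simp add: vec_eq_iff laplacian_mult_nth one_vec_def cong: if_cong)

text \<open>The quadratic form satisfies
  \<open>2 (v \<bullet> L v) = \<Sum>\<^sub>i\<^sub>j w\<^sub>i\<^sub>j (v\<^sub>i - v\<^sub>j)\<^sup>2\<close>. If \<open>L v = 0\<close>, then each term of this sum of
  nonnegative terms vanishes, so \<open>v\<close> does not change along an edge, hence not along a path.\<close>
lemma laplacian_kernel_constant:
  fixes v :: "real^'n"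
  assumes sym: "sym E" and conn: "\<And>i j. (i, j) \<in> E\<^sup>*"
    and pos: "\<And>i j. (i, j) \<in> E \<Longrightarrow> 0 < w i j"
    and wsym: "\<And>i j. (i, j) \<in> E \<Longrightarrow> w i j = w j i"
    and ker: "laplacian E w *v v = 0"
  shows "v $ i = v $ j"
proof -
  let ?a = "\<lambda>i j. if (i, j) \<in> E then w i j else 0"
  have a_sym: "?a i j = ?a j i" for i j
    using sym wsym by (auto dest: symD)
  have "(\<Sum>i\<in>UNIV. \<Sum>j\<in>UNIV. v $ i * (?a i j * (v $ i - v $ j))) = 0"
  proof -
    have "(\<Sum>i\<in>UNIV. v $ i * (laplacian E w *v v) $ i) = 0"
      by (simp add: ker)
    moreover have "(laplacian E w *v v) $ i = (\<Sum>j\<in>UNIV. ?a i j * (v $ i - v $ j))" for i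
      unfolding laplacian_mult_nth[OF sym] by (intro sum.cong) auto
    ultimately show ?thesis
      by (simp only: sum_distrib_left)
  qed
  \<comment> \<open>Exchanging the names of the two indices and using the symmetry of the weights gives the same
    sum with \<open>- v $ j\<close> in place of \<open>v $ i\<close>; adding the two produces the squares.\<close>
  moreover have "(\<Sum>i\<in>UNIV. \<Sum>j\<in>UNIV. v $ i * (?a i j * (v $ i - v $ j))) =
      (\<Sum>i\<in>UNIV. \<Sum>j\<in>UNIV. - (v $ j * (?a i j * (v $ i - v $ j))))"
    by (subst sum.swap, subst a_sym) (intro sum.cong, auto simp: algebra_simps)
  ultimately have "(\<Sum>i\<in>UNIV. \<Sum>j\<in>UNIV. v $ i * (?a i j * (v $ i - v $ j)) +
      - (v $ j * (?a i j * (v $ i - v $ j)))) = 0"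
    by (simp only: sum.distrib)
  moreover have "v $ i * (?a i j * (v $ i - v $ j)) + - (v $ j * (?a i j * (v $ i - v $ j))) =
      ?a i j * (v $ i - v $ j)\<^sup>2" for i j
    by (simp add: power2_eq_square algebra_simps)
  ultimately have "(\<Sum>i\<in>UNIV. \<Sum>j\<in>UNIV. ?a i j * (v $ i - v $ j)\<^sup>2) = 0"
    by simp
  moreover have "0 \<le> ?a i j * (v $ i - v $ j)\<^sup>2" for i j
    using pos[of i j] by auto
  ultimately have z: "?a i j * (v $ i - v $ j)\<^sup>2 = 0" for i j
    by (auto simp: sum_nonneg_eq_0_iff sum_nonneg)
  have edge: "v $ i = v $ j" if "(i, j) \<in> E" for i j
    using that pos[OF that] z[of i j] by simp
  from conn[of i j] show ?thesis
    by (induction rule: rtrancl_induct) (auto dest: edge)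
qed

text \<open>Connectedness enters the theorem here only: it makes the eigenvalue \<open>0\<close> simple, so that the
  division by \<open>\<lambda>\<^sub>i\<close> in \<open>\<theta>\<^sub>i\<close> is meaningful. An eigenvector for \<open>0\<close> is a constant vector, and two
  nonzero constant vectors are not orthogonal.\<close>
lemma laplacian_eigenvalue_eq_0_iff:
  fixes \<xi> :: "'n \<Rightarrow> real^'n"
  assumes sym: "sym E" and conn: "\<And>i j. (i, j) \<in> E\<^sup>*"
    and pos: "\<And>i j. (i, j) \<in> E \<Longrightarrow> 0 < w i j"
    and wsym: "\<And>i j. (i, j) \<in> E \<Longrightarrow> w i j = w j i"
    and on: "\<And>i j. \<xi> i \<bullet> \<xi> j = (if i = j then 1 else 0)"
    and ev: "\<And>k. laplacian E w *v \<xi> k = lam k *\<^sub>R \<xi> k"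
    and one: "\<xi> k\<^sub>0 = r *\<^sub>R 1"
  shows "lam k = 0 \<longleftrightarrow> k = k\<^sub>0"
proof
  assume "lam k = 0"
  then have ker: "laplacian E w *v \<xi> k = 0"
    by (simp add: ev)
  \<comment> \<open>An arbitrary index, where the common value of the coordinates is read off.\<close>
  define i\<^sub>0 :: 'n where "i\<^sub>0 = undefined"
  have "\<xi> k $ i = \<xi> k $ i\<^sub>0" for i
    by (rule laplacian_kernel_constant[OF sym conn pos wsym ker])
  then have k: "\<xi> k = (\<xi> k $ i\<^sub>0) *\<^sub>R 1"
    by (simp add: vec_eq_iff one_vec_def)
  have "r \<noteq> 0" "\<xi> k $ i\<^sub>0 \<noteq> 0"
    using on[of k\<^sub>0 k\<^sub>0] on[of k k] one k by auto
  moreover have "\<xi> k \<bullet> \<xi> k\<^sub>0 = (\<xi> k $ i\<^sub>0) * r * real CARD('n)"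
    by (subst k, subst one) (simp add: inner_vec_def one_vec_def)
  ultimately have "\<xi> k \<bullet> \<xi> k\<^sub>0 \<noteq> 0"
    by simp
  then show "k = k\<^sub>0"
    using on[of k k\<^sub>0] by (auto split: if_splits)
next
  assume k: "k = k\<^sub>0"
  have "lam k *\<^sub>R \<xi> k = laplacian E w *v \<xi> k"
    by (rule ev[symmetric])
  also have "\<dots> = 0"
    unfolding k one by (simp add: matrix_vector_mult_scaleR laplacian_mult_one[OF sym])
  finally have "lam k *\<^sub>R \<xi> k = 0" .
  moreover have "\<xi> k \<noteq> 0"
    using on[of k k] by auto
  ultimately show "lam k = 0"
    by simp
qed

section \<open>Integrals along a fixed path\<close>

text \<open>The Cauchy--Schwarz inequality against the constant function \<open>1\<close>: the integral of \<open>(g - m)\<^sup>2\<close>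
  is nonnegative, where \<open>m\<close> is the average of \<open>g\<close>.\<close>
lemma square_integral_le:
  fixes g :: "real \<Rightarrow> real"
  assumes t: "0 \<le> t" and g: "continuous_on {0..t} g"
  shows "(integral {0..t} g)\<^sup>2 \<le> t * integral {0..t} (\<lambda>s. (g s)\<^sup>2)"
proof (cases "t = 0")
  case False
  define m where "m = integral {0..t} g / t"
  have i1: "(g has_integral m * t) {0..t}"
    using integrable_integral[OF integrable_continuous_real[OF g]] False by (simp add: m_def)
  have i2: "((\<lambda>s. (g s)\<^sup>2) has_integral integral {0..t} (\<lambda>s. (g s)\<^sup>2)) {0..t}"
    by (intro integrable_integral integrable_continuous_real continuous_intros g)
  have i3: "((\<lambda>s. m\<^sup>2) has_integral m\<^sup>2 * t) {0..t}"
    using has_integral_const_real[of "m\<^sup>2" 0 t] t by (simp add: mult.commute)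
  have "((\<lambda>s. (g s)\<^sup>2 - 2 * m * g s + m\<^sup>2) has_integral
      integral {0..t} (\<lambda>s. (g s)\<^sup>2) - 2 * m * (m * t) + m\<^sup>2 * t) {0..t}"
    by (intro has_integral_add has_integral_diff has_integral_mult_right i1 i2 i3)
  then have "((\<lambda>s. (g s - m)\<^sup>2) has_integral
      integral {0..t} (\<lambda>s. (g s)\<^sup>2) - 2 * m * (m * t) + m\<^sup>2 * t) {0..t}"
    by (simp add: power2_diff algebra_simps)
  then have "0 \<le> integral {0..t} (\<lambda>s. (g s)\<^sup>2) - 2 * m * (m * t) + m\<^sup>2 * t"
    by (rule has_integral_nonneg) simp
  then have "m\<^sup>2 * t \<le> integral {0..t} (\<lambda>s. (g s)\<^sup>2)"
    by (simp add: power2_eq_square)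
  then have "t * (m\<^sup>2 * t) \<le> t * integral {0..t} (\<lambda>s. (g s)\<^sup>2)"
    using t by (rule mult_left_mono)
  moreover have "t * (m\<^sup>2 * t) = (integral {0..t} g)\<^sup>2"
    using False by (simp add: m_def power2_eq_square)
  ultimately show ?thesis
    by simp
qed simp

text \<open>The integral \<open>\<integral>\<^sub>0\<^sup>t f dp\<close> of a smooth function against a continuous path with \<open>p(0) = 0\<close>,
  written through integration by parts, with \<open>f'\<close> the derivative of \<open>f\<close>. It is a functional of the
  single path, so no stochastic limit is involved.\<close>
definition wiener_integral ::
    "(real \<Rightarrow> real) \<Rightarrow> (real \<Rightarrow> real) \<Rightarrow> real \<Rightarrow> (real \<Rightarrow> real) \<Rightarrow> real" where
  "wiener_integral f f' t p = f t * p t - integral {0..t} (\<lambda>s. f' s * p s)"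

lemma wiener_integral_cong:
  "0 \<le> t \<Longrightarrow> (\<And>s. s \<in> {0..t} \<Longrightarrow> p s = q s) \<Longrightarrow> wiener_integral f f' t p = wiener_integral f f' t q"
  unfolding wiener_integral_def by (auto intro!: arg_cong2[of _ _ _ _ "(-)"] integral_cong)

lemma wiener_integral_cmult:
  "wiener_integral f f' t (\<lambda>s. r * p s) = r * wiener_integral f f' t p"
  by (simp add: wiener_integral_def mult.left_commute[of _ r] right_diff_distrib)

text \<open>This and the next lemma undo the integration by parts for the two functions that arise as
  covariances. The function \<open>s \<mapsto> min s r\<close> has slope \<open>1\<close> up to \<open>r\<close> and slope \<open>0\<close> afterwards.\<close>
lemma wiener_integral_min:
  assumes r: "r \<in> {0..t}"
    and f: "\<And>s. s \<in> {0..t} \<Longrightarrow> (f has_real_derivative f' s) (at s within {0..t})"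
  shows "wiener_integral f f' t (\<lambda>s. min s r) = integral {0..r} f"
proof -
  have cont: "continuous_on {0..t} f"
    by (rule DERIV_continuous_on[OF f])
  have "((\<lambda>s. f' s * s) has_integral (r * f r - integral {0..r} f) - (0 * f 0 - integral {0..0} f)) {0..r}"
  proof (rule fundamental_theorem_of_calculus)
    fix s assume s: "s \<in> {0..r}"
    have "continuous_on {0..r} f"
      using cont by (rule continuous_on_subset) (use r in auto)
    then have "((\<lambda>s. integral {0..s} f) has_real_derivative f s) (at s within {0..r})"
      using s by (rule integral_has_real_derivative)
    moreover have "(f has_real_derivative f' s) (at s within {0..r})"
      using f by (rule DERIV_subset) (use r s in auto)
    ultimately show "((\<lambda>s. s * f s - integral {0..s} f) has_vector_derivative f' s * s) (at s within {0..r})"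
      unfolding has_real_derivative_iff_has_vector_derivative[symmetric]
      by (auto intro!: derivative_eq_intros)
  qed (use r in auto)
  then have 1: "((\<lambda>s. f' s * min s r) has_integral r * f r - integral {0..r} f) {0..r}"
    by (subst has_integral_cong[of _ _ "\<lambda>s. f' s * s"]) auto
  have "((\<lambda>s. f' s * r) has_integral f t * r - f r * r) {r..t}"
  proof (rule fundamental_theorem_of_calculus)
    fix s assume s: "s \<in> {r..t}"
    have "(f has_real_derivative f' s) (at s within {r..t})"
      using f by (rule DERIV_subset) (use r s in auto)
    then show "((\<lambda>s. f s * r) has_vector_derivative f' s * r) (at s within {r..t})"
      unfolding has_real_derivative_iff_has_vector_derivative[symmetric]
      by (auto intro!: derivative_eq_intros)
  qed (use r in auto)
  then have 2: "((\<lambda>s. f' s * min s r) has_integral f t * r - f r * r) {r..t}"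
    by (subst has_integral_cong[of _ _ "\<lambda>s. f' s * r"]) auto
  have "((\<lambda>s. f' s * min s r) has_integral
      r * f r - integral {0..r} f + (f t * r - f r * r)) {0..t}"
    by (rule has_integral_combine[OF _ _ 1 2]) (use r in auto)
  then show ?thesis
    using r by (simp add: wiener_integral_def integral_unique min_absorb2 algebra_simps)
qed

lemma wiener_integral_indefinite_integral:
  assumes t: "0 \<le> t"
    and f: "\<And>s. s \<in> {0..t} \<Longrightarrow> (f has_real_derivative f' s) (at s within {0..t})"
    and g: "continuous_on {0..t} g"
  shows "wiener_integral f f' t (\<lambda>s. integral {0..s} g) = integral {0..t} (\<lambda>s. f s * g s)"
proof -
  have cont: "continuous_on {0..t} (\<lambda>s. f s * g s)"
    using DERIV_continuous_on[OF f] g by (intro continuous_on_mult)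
  have "((\<lambda>s. f' s * integral {0..s} g) has_integral
      (f t * integral {0..t} g - integral {0..t} (\<lambda>s. f s * g s)) -
      (f 0 * integral {0..0} g - integral {0..0} (\<lambda>s. f s * g s))) {0..t}"
  proof (rule fundamental_theorem_of_calculus[OF t])
    fix s assume s: "s \<in> {0..t}"
    show "((\<lambda>s. f s * integral {0..s} g - integral {0..s} (\<lambda>s. f s * g s)) has_vector_derivative
        f' s * integral {0..s} g) (at s within {0..t})"
      unfolding has_real_derivative_iff_has_vector_derivative[symmetric]
      using f[OF s] integral_has_real_derivative[OF cont s] integral_has_real_derivative[OF g s]
      by (auto intro!: derivative_eq_intros)
  qed
  then show ?thesis
    by (simp add: wiener_integral_def integral_unique)
qed

lemma integral_squared_exponential:
  fixes l t :: real
  assumes "l \<noteq> 0" "0 \<le> t"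
  shows "integral {0..t} (\<lambda>s. exp (- (l * (t - s))) * exp (- (l * (t - s)))) =
    (1 - exp (- 2 * l * t)) / (2 * l)"
proof -
  have "((\<lambda>s. exp (- (l * (t - s))) * exp (- (l * (t - s)))) has_integral
      exp (- 2 * l * (t - t)) / (2 * l) - exp (- 2 * l * (t - 0)) / (2 * l)) {0..t}"
    using assms
    by (intro fundamental_theorem_of_calculus)
      (auto simp: has_real_derivative_iff_has_vector_derivative[symmetric] exp_add[symmetric]
        field_simps intro!: derivative_eq_intros)
  then show ?thesis
    by (simp add: integral_unique diff_divide_distrib)
qed

text \<open>Variation of constants. The path \<open>y\<close> is as rough as \<open>W\<close>, but its integral
  \<open>I(s) = \<integral>\<^sub>0\<^sup>s y\<close> is differentiable and satisfies \<open>I' + l I = y\<^sub>0 + a W\<close>. Multiplying by the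
  integrating factor and integrating determines \<open>I\<close>, and the equation then determines \<open>y\<close>.\<close>
lemma linear_integral_equation_solution:
  fixes y W :: "real \<Rightarrow> real"
  assumes t: "0 \<le> t" and y: "continuous_on {0..t} y" and W: "continuous_on {0..t} W"
    and eq: "\<And>s. s \<in> {0..t} \<Longrightarrow> y s = y0 - l * integral {0..s} y + a * W s"
  shows "y t = exp (- (l * t)) * y0 +
     a * (W t - integral {0..t} (\<lambda>s. l * exp (- (l * (t - s))) * W s))"
proof -
  let ?I = "\<lambda>s. integral {0..s} y"
  let ?J = "integral {0..t} (\<lambda>s. l * exp (- (l * (t - s))) * W s)"
  have I': "(?I has_real_derivative y s) (at s within {0..t})" if "s \<in> {0..t}" for s
    by (rule integral_has_real_derivative[OF y that])
  have "((\<lambda>s. l * exp (- (l * (t - s))) * (y0 + a * W s)) has_integral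
      (l * exp (- (l * (t - t))) * ?I t - l * exp (- (l * (t - 0))) * ?I 0)) {0..t}"
  proof (rule fundamental_theorem_of_calculus[OF t])
    fix s assume s: "s \<in> {0..t}"
    have "((\<lambda>s. l * exp (- (l * (t - s))) * ?I s) has_real_derivative
        l * (exp (- (l * (t - s))) * l) * ?I s + l * exp (- (l * (t - s))) * y s) (at s within {0..t})"
      using I'[OF s] by (auto intro!: derivative_eq_intros)
    also have "l * (exp (- (l * (t - s))) * l) * ?I s + l * exp (- (l * (t - s))) * y s =
        l * exp (- (l * (t - s))) * (y0 + a * W s)"
      by (subst eq[OF s]) (simp add: algebra_simps)
    finally show "((\<lambda>s. l * exp (- (l * (t - s))) * ?I s) has_vector_derivative
        l * exp (- (l * (t - s))) * (y0 + a * W s)) (at s within {0..t})"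
      by (simp add: has_real_derivative_iff_has_vector_derivative)
  qed
  then have 1: "((\<lambda>s. l * exp (- (l * (t - s))) * (y0 + a * W s)) has_integral l * ?I t) {0..t}"
    by simp
  have "((\<lambda>s. y0 * (l * exp (- (l * (t - s))))) has_integral
      (y0 * exp (- (l * (t - t))) - y0 * exp (- (l * (t - 0))))) {0..t}"
    by (rule fundamental_theorem_of_calculus[OF t])
      (auto simp: has_real_derivative_iff_has_vector_derivative[symmetric]
        intro!: derivative_eq_intros)
  then have 2: "((\<lambda>s. y0 * (l * exp (- (l * (t - s))))) has_integral (y0 - y0 * exp (- (l * t)))) {0..t}"
    by simp
  have "(\<lambda>s. l * exp (- (l * (t - s))) * W s) integrable_on {0..t}"
    by (intro integrable_continuous_real continuous_intros W)
  then have 3: "((\<lambda>s. a * (l * exp (- (l * (t - s))) * W s)) has_integral a * ?J) {0..t}"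
    by (intro has_integral_mult_right integrable_integral)
  have "((\<lambda>s. l * exp (- (l * (t - s))) * (y0 + a * W s)) has_integral
      (y0 - y0 * exp (- (l * t)) + a * ?J)) {0..t}"
    using has_integral_add[OF 2 3] by (simp add: algebra_simps)
  with 1 have "l * ?I t = y0 - y0 * exp (- (l * t)) + a * ?J"
    by (rule has_integral_unique)
  then show ?thesis
    using eq[of t] t by (simp add: algebra_simps)
qed

section \<open>Square integrable variables and processes\<close>

lemma abs_mult_le_sum_squares: "\<bar>x * y\<bar> \<le> x\<^sup>2 + y\<^sup>2" for x y :: real
proof -
  have "2 * (\<bar>x\<bar> * \<bar>y\<bar>) \<le> x\<^sup>2 + y\<^sup>2"
    using sum_squares_bound[of "\<bar>x\<bar>" "\<bar>y\<bar>"] by (simp add: mult.assoc)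
  moreover have "0 \<le> \<bar>x\<bar> * \<bar>y\<bar>"
    by simp
  ultimately show ?thesis
    unfolding abs_mult by linarith
qed

context prob_space
begin

definition square_integrable :: "('a \<Rightarrow> real) \<Rightarrow> bool" where
  "square_integrable X \<longleftrightarrow> X \<in> borel_measurable M \<and> integrable M (\<lambda>\<omega>. (X \<omega>)\<^sup>2)"

lemma square_integrable_measurable[measurable_dest]:
  "square_integrable X \<Longrightarrow> X \<in> borel_measurable M"
  by (simp add: square_integrable_def)

lemma square_integrable_mult:
  assumes "square_integrable X" "square_integrable Y"
  shows "integrable M (\<lambda>\<omega>. X \<omega> * Y \<omega>)"
proof (rule Bochner_Integration.integrable_bound)
  show "integrable M (\<lambda>\<omega>. (X \<omega>)\<^sup>2 + (Y \<omega>)\<^sup>2)"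
    using assms by (simp add: square_integrable_def)
  show "AE \<omega> in M. norm (X \<omega> * Y \<omega>) \<le> norm ((X \<omega>)\<^sup>2 + (Y \<omega>)\<^sup>2)"
    by (simp add: abs_mult_le_sum_squares)
qed (use assms in measurable)

lemma square_integrable_const: "square_integrable (\<lambda>_. r)"
  by (simp add: square_integrable_def)

lemma square_integrable_integrable: "square_integrable X \<Longrightarrow> integrable M X"
  using square_integrable_mult[OF _ square_integrable_const[of 1]] by simp

lemma square_integrable_cmult: "square_integrable X \<Longrightarrow> square_integrable (\<lambda>\<omega>. r * X \<omega>)"
  by (auto simp: square_integrable_def power_mult_distrib)

lemma square_integrable_add:
  assumes "square_integrable X" "square_integrable Y"
  shows "square_integrable (\<lambda>\<omega>. X \<omega> + Y \<omega>)"
  using assms square_integrable_mult[OF assms]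
  by (auto simp: square_integrable_def power2_sum mult.assoc)

lemma square_integrable_diff:
  assumes "square_integrable X" "square_integrable Y"
  shows "square_integrable (\<lambda>\<omega>. X \<omega> - Y \<omega>)"
  using square_integrable_add[OF assms(1) square_integrable_cmult[OF assms(2), of "-1"]] by simp

lemma square_integrable_sum:
  "(\<And>k. k \<in> A \<Longrightarrow> square_integrable (X k)) \<Longrightarrow> square_integrable (\<lambda>\<omega>. \<Sum>k\<in>A. X k \<omega>)"
  by (induction A rule: infinite_finite_induct)
    (auto intro: square_integrable_add square_integrable_const)

lemma square_integrable_cong_AE:
  assumes "square_integrable X" "Y \<in> borel_measurable M" "AE \<omega> in M. Y \<omega> = X \<omega>"
  shows "square_integrable Y"
proof -
  have "integrable M (\<lambda>\<omega>. (Y \<omega>)\<^sup>2) \<longleftrightarrow> integrable M (\<lambda>\<omega>. (X \<omega>)\<^sup>2)"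
    using assms by (intro integrable_cong_AE) (auto simp: square_integrable_def)
  then show ?thesis
    using assms by (simp add: square_integrable_def)
qed

text \<open>The properties under which expectation and integration over \<open>[0,t]\<close> can be exchanged by
  Fubini's theorem. Paths are continuous for every \<open>\<omega>\<close>, not only almost surely, so that the integral
  along a path is a Lebesgue integral everywhere; a modification on a null set achieves this.\<close>
definition square_integrable_process :: "real \<Rightarrow> (real \<Rightarrow> 'a \<Rightarrow> real) \<Rightarrow> bool" where
  "square_integrable_process t P \<longleftrightarrow>
     (\<lambda>(s, \<omega>). P s \<omega>) \<in> borel_measurable (borel \<Otimes>\<^sub>M M) \<and>
     (\<forall>\<omega>. continuous_on {0..t} (\<lambda>s. P s \<omega>)) \<and>
     (\<forall>s\<in>{0..t}. square_integrable (P s)) \<and>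
     (\<exists>C. \<forall>s\<in>{0..t}. expectation (\<lambda>\<omega>. (P s \<omega>)\<^sup>2) \<le> C)"

lemma square_integrable_process_constant:
  assumes "square_integrable Z"
  shows "square_integrable_process t (\<lambda>_. Z)"
proof -
  have [measurable]: "Z \<in> borel_measurable M"
    using assms by measurable
  have "(\<lambda>(s, \<omega>). Z \<omega>) \<in> borel_measurable (borel \<Otimes>\<^sub>M M)"
    by measurable
  then show ?thesis
    using assms unfolding square_integrable_process_def by auto
qed

lemma square_integrable_process_product_measure:
  assumes P: "square_integrable_process t P"
  shows "integrable (lborel \<Otimes>\<^sub>M M) (\<lambda>(s, \<omega>). indicator {0..t} s * (P s \<omega>)\<^sup>2)"
proof -
  interpret pair_sigma_finite lborel M ..
  have [measurable]: "(\<lambda>(s, \<omega>). P s \<omega>) \<in> borel_measurable (borel \<Otimes>\<^sub>M M)"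
    using P by (simp add: square_integrable_process_def)
  obtain C where C: "\<And>s. s \<in> {0..t} \<Longrightarrow> expectation (\<lambda>\<omega>. (P s \<omega>)\<^sup>2) \<le> C"
    using P unfolding square_integrable_process_def by blast
  have P2: "integrable M (\<lambda>\<omega>. (P s \<omega>)\<^sup>2)" if "s \<in> {0..t}" for s
    using P that by (auto simp: square_integrable_process_def square_integrable_def)
  show ?thesis
  proof (rule Fubini_integrable)
    show "integrable lborel (\<lambda>s. LINT \<omega>|M. norm (case (s, \<omega>) of (s, \<omega>) \<Rightarrow> indicator {0..t} s * (P s \<omega>)\<^sup>2))"
    proof (rule Bochner_Integration.integrable_bound)
      show "integrable lborel (\<lambda>s. C * indicator {0..t} s)"
        by (intro integrable_mult_right integrable_real_indicator) (auto simp: emeasure_lborel_Icc_eq)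
      show "AE s in lborel. norm (LINT \<omega>|M. norm (case (s, \<omega>) of (s, \<omega>) \<Rightarrow> indicator {0..t} s * (P s \<omega>)\<^sup>2)) \<le>
          norm (C * indicator {0..t} s)"
        using C by (auto simp: indicator_def intro!: AE_I2 order_trans[OF C])
    qed measurable
    show "AE s in lborel. integrable M (\<lambda>\<omega>. case (s, \<omega>) of (s, \<omega>) \<Rightarrow> indicator {0..t} s * (P s \<omega>)\<^sup>2)"
      using P2 by (auto simp: indicator_def)
  qed measurable
qed

text \<open>Since \<open>h\<close> is bounded on \<open>[0,t]\<close> by some \<open>H\<close>, the square of the integral is at most
  \<open>t H\<^sup>2 \<integral>\<^sub>0\<^sup>t P(s)\<^sup>2 ds\<close>, which has finite expectation. For the second claim
  \<open>\<bar>P(s) Z\<bar> \<le> P(s)\<^sup>2 + Z\<^sup>2\<close> provides the integrable majorant on the product space that Fubini's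
  theorem needs; \<open>Z\<close> is treated there as a process that is constant in time.\<close>
lemma
  assumes t: "0 \<le> t" and P: "square_integrable_process t P" and h: "continuous_on {0..t} h"
  shows square_integrable_time_integral:
      "square_integrable (\<lambda>\<omega>. integral {0..t} (\<lambda>s. h s * P s \<omega>))"
    and expectation_time_integral_mult:
      "square_integrable Z \<Longrightarrow> expectation (\<lambda>\<omega>. integral {0..t} (\<lambda>s. h s * P s \<omega>) * Z \<omega>) =
        integral {0..t} (\<lambda>s. h s * expectation (\<lambda>\<omega>. P s \<omega> * Z \<omega>))"
proof -
  interpret pair_sigma_finite lborel M ..
  have P_meas [measurable]: "(\<lambda>(s, \<omega>). P s \<omega>) \<in> borel_measurable (borel \<Otimes>\<^sub>M M)"
    and P_cont: "\<And>\<omega>. continuous_on {0..t} (\<lambda>s. P s \<omega>)"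
    using P by (auto simp: square_integrable_process_def)
  note P2 = square_integrable_process_product_measure[OF P]
  obtain H where H: "\<And>s. s \<in> {0..t} \<Longrightarrow> \<bar>h s\<bar> \<le> H"
    using compact_imp_bounded[OF compact_continuous_image[OF h compact_Icc]]
    unfolding bounded_iff by (metis imageI real_norm_def)
  then have H0: "0 \<le> H"
    using t by (force intro: order_trans[OF abs_ge_zero])
  define k where "k s = indicator {0..t} s * h s" for s
  have k_meas [measurable]: "k \<in> borel_measurable borel"
    using borel_measurable_continuous_on_indicator[OF _ h] by (simp add: k_def[abs_def])
  have I: "integral {0..t} (\<lambda>s. h s * P s \<omega>) = (LINT s|lborel. k s * P s \<omega>)" for \<omega>
  proof -
    have "set_integrable lborel {0..t} (\<lambda>s. h s * P s \<omega>)"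
      by (intro borel_integrable_atLeastAtMost' continuous_intros h P_cont)
    from set_borel_integral_eq_integral(2)[OF this] show ?thesis
      by (simp add: set_lebesgue_integral_def k_def mult.assoc)
  qed
  show "square_integrable (\<lambda>\<omega>. integral {0..t} (\<lambda>s. h s * P s \<omega>))"
    unfolding square_integrable_def
  proof
    show meas: "(\<lambda>\<omega>. integral {0..t} (\<lambda>s. h s * P s \<omega>)) \<in> borel_measurable M"
      unfolding I by measurable
    have "integrable M (\<lambda>\<omega>. LINT s|lborel. indicator {0..t} s * (P s \<omega>)\<^sup>2)"
      using integrable_snd[OF P2] by simp
    then have "integrable M (\<lambda>\<omega>. t * H\<^sup>2 * (LINT s|lborel. indicator {0..t} s * (P s \<omega>)\<^sup>2))"
      by simp
    then show "integrable M (\<lambda>\<omega>. (integral {0..t} (\<lambda>s. h s * P s \<omega>))\<^sup>2)"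
    proof (rule Bochner_Integration.integrable_bound)
      show "AE \<omega> in M. norm ((integral {0..t} (\<lambda>s. h s * P s \<omega>))\<^sup>2) \<le>
          norm (t * H\<^sup>2 * (LINT s|lborel. indicator {0..t} s * (P s \<omega>)\<^sup>2))"
      proof (rule AE_I2)
        fix \<omega>
        have "(integral {0..t} (\<lambda>s. h s * P s \<omega>))\<^sup>2 \<le> t * integral {0..t} (\<lambda>s. (h s * P s \<omega>)\<^sup>2)"
          by (intro square_integral_le t continuous_intros h P_cont)
        also have "\<dots> \<le> t * integral {0..t} (\<lambda>s. H\<^sup>2 * (P s \<omega>)\<^sup>2)"
          using H H0
          by (intro mult_left_mono[OF integral_le t] integrable_continuous_real continuous_intros h P_cont)
            (auto simp: power_mult_distrib abs_le_square_iff[symmetric] intro!: mult_right_mono)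
        also have "\<dots> = t * H\<^sup>2 * integral {0..t} (\<lambda>s. P s \<omega> * P s \<omega>)"
          by (simp add: power2_eq_square)
        also have "\<dots> = t * H\<^sup>2 * (LINT s|lborel. indicator {0..t} s * (P s \<omega>)\<^sup>2)"
        proof -
          have "set_integrable lborel {0..t} (\<lambda>s. P s \<omega> * P s \<omega>)"
            by (intro borel_integrable_atLeastAtMost' continuous_intros P_cont)
          from set_borel_integral_eq_integral(2)[OF this] show ?thesis
            by (simp add: set_lebesgue_integral_def power2_eq_square)
        qed
        finally show "norm ((integral {0..t} (\<lambda>s. h s * P s \<omega>))\<^sup>2) \<le>
          norm (t * H\<^sup>2 * (LINT s|lborel. indicator {0..t} s * (P s \<omega>)\<^sup>2))"
          by simp
      qed
    qed (use meas in measurable)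
  qed
  assume Z: "square_integrable Z"
  then have Z_meas [measurable]: "Z \<in> borel_measurable M"
    by measurable
  note Z2 = square_integrable_process_product_measure[OF square_integrable_process_constant[OF Z], of t]
  have int: "integrable (lborel \<Otimes>\<^sub>M M) (\<lambda>(s, \<omega>). k s * P s \<omega> * Z \<omega>)"
  proof (rule Bochner_Integration.integrable_bound)
    show "integrable (lborel \<Otimes>\<^sub>M M) (\<lambda>x. H * ((\<lambda>(s, \<omega>). indicator {0..t} s * (P s \<omega>)\<^sup>2) x +
        (\<lambda>(s, \<omega>). indicator {0..t} s * (Z \<omega>)\<^sup>2) x))"
      by (intro integrable_mult_right Bochner_Integration.integrable_add P2 Z2)
    have "\<bar>k s * P s \<omega> * Z \<omega>\<bar> \<le> H * (indicator {0..t} s * (P s \<omega>)\<^sup>2 + indicator {0..t} s * (Z \<omega>)\<^sup>2)" for s \<omega>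
    proof (cases "s \<in> {0..t}")
      case True
      have "\<bar>P s \<omega> * Z \<omega>\<bar> \<le> (P s \<omega>)\<^sup>2 + (Z \<omega>)\<^sup>2"
        by (rule abs_mult_le_sum_squares)
      then have "\<bar>h s\<bar> * \<bar>P s \<omega> * Z \<omega>\<bar> \<le> H * ((P s \<omega>)\<^sup>2 + (Z \<omega>)\<^sup>2)"
        using H[OF True] H0 by (intro mult_mono) auto
      then show ?thesis
        using True by (simp add: k_def abs_mult mult.assoc)
    qed (auto simp: k_def)
    then show "AE x in lborel \<Otimes>\<^sub>M M. norm (case x of (s, \<omega>) \<Rightarrow> k s * P s \<omega> * Z \<omega>) \<le>
        norm (H * ((\<lambda>(s, \<omega>). indicator {0..t} s * (P s \<omega>)\<^sup>2) x + (\<lambda>(s, \<omega>). indicator {0..t} s * (Z \<omega>)\<^sup>2) x))"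
      by (auto intro!: AE_I2 intro: order_trans[OF _ abs_ge_self])
  qed measurable
  have "expectation (\<lambda>\<omega>. integral {0..t} (\<lambda>s. h s * P s \<omega>) * Z \<omega>) =
      expectation (\<lambda>\<omega>. LINT s|lborel. k s * P s \<omega> * Z \<omega>)"
    unfolding I by simp
  also have "\<dots> = (LINT s|lborel. expectation (\<lambda>\<omega>. k s * P s \<omega> * Z \<omega>))"
    by (rule Fubini_integral[OF int])
  also have "\<dots> = (LINT s|lborel. indicator {0..t} s *\<^sub>R (h s * expectation (\<lambda>\<omega>. P s \<omega> * Z \<omega>)))"
    by (simp add: k_def mult.assoc)
  also have "\<dots> = integral {0..t} (\<lambda>s. h s * expectation (\<lambda>\<omega>. P s \<omega> * Z \<omega>))"
  proof -
    have "integrable lborel (\<lambda>s. expectation (\<lambda>\<omega>. k s * P s \<omega> * Z \<omega>))"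
      using integrable_fst[OF int] by simp
    then have "set_integrable lborel {0..t} (\<lambda>s. h s * expectation (\<lambda>\<omega>. P s \<omega> * Z \<omega>))"
      by (simp add: set_integrable_def k_def mult.assoc)
    from set_borel_integral_eq_integral(2)[OF this] show ?thesis
      by (simp add: set_lebesgue_integral_def)
  qed
  finally show "expectation (\<lambda>\<omega>. integral {0..t} (\<lambda>s. h s * P s \<omega>) * Z \<omega>) =
        integral {0..t} (\<lambda>s. h s * expectation (\<lambda>\<omega>. P s \<omega> * Z \<omega>))" .
qed

section \<open>The Ito isometry for smooth integrands\<close>

text \<open>Pairing with a fixed square integrable variable \<open>Z\<close> turns the integral of the random path into
  the integral of the deterministic path \<open>s \<mapsto> E(P(s) Z)\<close>.\<close>
lemma
  assumes t: "0 \<le> t" and P: "square_integrable_process t P" and f': "continuous_on {0..t} f'"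
  shows square_integrable_wiener_integral:
      "square_integrable (\<lambda>\<omega>. wiener_integral f f' t (\<lambda>s. P s \<omega>))"
    and expectation_wiener_integral_mult:
      "square_integrable Z \<Longrightarrow> expectation (\<lambda>\<omega>. wiener_integral f f' t (\<lambda>s. P s \<omega>) * Z \<omega>) =
        wiener_integral f f' t (\<lambda>s. expectation (\<lambda>\<omega>. P s \<omega> * Z \<omega>))"
proof -
  have Pt: "square_integrable (P t)"
    using P t by (auto simp: square_integrable_process_def)
  note I = square_integrable_time_integral[OF t P f']
  show "square_integrable (\<lambda>\<omega>. wiener_integral f f' t (\<lambda>s. P s \<omega>))"
    unfolding wiener_integral_def
    by (intro square_integrable_diff square_integrable_cmult Pt I)
  assume Z: "square_integrable Z"
  have "expectation (\<lambda>\<omega>. wiener_integral f f' t (\<lambda>s. P s \<omega>) * Z \<omega>) =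
      expectation (\<lambda>\<omega>. f t * (P t \<omega> * Z \<omega>) - integral {0..t} (\<lambda>s. f' s * P s \<omega>) * Z \<omega>)"
    by (simp add: wiener_integral_def left_diff_distrib mult.assoc)
  also have "\<dots> = f t * expectation (\<lambda>\<omega>. P t \<omega> * Z \<omega>) -
      expectation (\<lambda>\<omega>. integral {0..t} (\<lambda>s. f' s * P s \<omega>) * Z \<omega>)"
    using square_integrable_mult[OF Pt Z] square_integrable_mult[OF I Z]
    by (subst Bochner_Integration.integral_diff) auto
  also have "\<dots> = wiener_integral f f' t (\<lambda>s. expectation (\<lambda>\<omega>. P s \<omega> * Z \<omega>))"
    by (simp add: wiener_integral_def expectation_time_integral_mult[OF t P f' Z])
  finally show "expectation (\<lambda>\<omega>. wiener_integral f f' t (\<lambda>s. P s \<omega>) * Z \<omega>) =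
        wiener_integral f f' t (\<lambda>s. expectation (\<lambda>\<omega>. P s \<omega> * Z \<omega>))" .
qed

lemma expectation_wiener_integral:
  assumes t: "0 \<le> t" and P: "square_integrable_process t P" and f': "continuous_on {0..t} f'"
    and mean: "\<And>s. s \<in> {0..t} \<Longrightarrow> expectation (P s) = 0"
  shows "expectation (\<lambda>\<omega>. wiener_integral f f' t (\<lambda>s. P s \<omega>)) = 0"
proof -
  have "expectation (\<lambda>\<omega>. wiener_integral f f' t (\<lambda>s. P s \<omega>)) =
      wiener_integral f f' t (\<lambda>s. expectation (P s))"
    using expectation_wiener_integral_mult[OF t P f' square_integrable_const[of 1]] by simp
  also have "\<dots> = wiener_integral f f' t (\<lambda>s. 0)"
    using mean by (intro wiener_integral_cong t) simp
  finally show ?thesis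
    by (simp add: wiener_integral_def)
qed

text \<open>The expectation is pulled through one integral at a time, and each time the remaining
  deterministic path is one for which the integration by parts can be undone: pairing
  \<open>\<integral>\<^sub>0\<^sup>t g dQ\<close> with \<open>P(s)\<close> leaves the path \<open>\<rho> min r s\<close>, with value \<open>\<rho> \<integral>\<^sub>0\<^sup>s g\<close>, and integrating \<open>f\<close>
  against the latter gives \<open>\<rho> \<integral>\<^sub>0\<^sup>t f g\<close>. The factor \<open>\<rho>\<close> is \<open>1\<close> for a Wiener process against itself
  and \<open>0\<close> for two independent ones.\<close>
lemma ito_isometry:
  assumes t: "0 \<le> t"
    and P: "square_integrable_process t P" and Q: "square_integrable_process t Q"
    and cov: "\<And>s r. s \<in> {0..t} \<Longrightarrow> r \<in> {0..t} \<Longrightarrow> expectation (\<lambda>\<omega>. P s \<omega> * Q r \<omega>) = \<rho> * min s r"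
    and f: "\<And>s. s \<in> {0..t} \<Longrightarrow> (f has_real_derivative f' s) (at s within {0..t})"
    and g: "\<And>s. s \<in> {0..t} \<Longrightarrow> (g has_real_derivative g' s) (at s within {0..t})"
    and f': "continuous_on {0..t} f'" and g': "continuous_on {0..t} g'"
  shows "expectation (\<lambda>\<omega>. wiener_integral f f' t (\<lambda>s. P s \<omega>) * wiener_integral g g' t (\<lambda>s. Q s \<omega>)) =
    \<rho> * integral {0..t} (\<lambda>s. f s * g s)"
proof -
  let ?G = "\<lambda>\<omega>. wiener_integral g g' t (\<lambda>s. Q s \<omega>)"
  have G: "square_integrable ?G"
    by (rule square_integrable_wiener_integral[OF t Q g'])
  have "expectation (\<lambda>\<omega>. P s \<omega> * ?G \<omega>) = \<rho> * integral {0..s} g" if s: "s \<in> {0..t}" for s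
  proof -
    have "square_integrable (P s)"
      using P s by (simp add: square_integrable_process_def)
    then have "expectation (\<lambda>\<omega>. ?G \<omega> * P s \<omega>) =
        wiener_integral g g' t (\<lambda>r. expectation (\<lambda>\<omega>. Q r \<omega> * P s \<omega>))"
      by (rule expectation_wiener_integral_mult[OF t Q g'])
    also have "\<dots> = wiener_integral g g' t (\<lambda>r. \<rho> * min r s)"
      using cov[OF s] by (intro wiener_integral_cong t) (simp add: mult.commute[of "Q _ _"] min.commute)
    also have "\<dots> = \<rho> * integral {0..s} g"
      using wiener_integral_min[of s t g g', OF s g] by (simp add: wiener_integral_cmult)
    finally show ?thesis
      by (simp add: mult.commute)
  qed
  then have "expectation (\<lambda>\<omega>. wiener_integral f f' t (\<lambda>s. P s \<omega>) * ?G \<omega>) =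
      wiener_integral f f' t (\<lambda>s. \<rho> * integral {0..s} g)"
    unfolding expectation_wiener_integral_mult[OF t P f' G]
    by (intro wiener_integral_cong t)
  also have "\<dots> = \<rho> * integral {0..t} (\<lambda>s. f s * g s)"
    using wiener_integral_indefinite_integral[of t f f' g, OF t f DERIV_continuous_on[OF g]]
    by (simp add: wiener_integral_cmult)
  finally show ?thesis .
qed

section \<open>Wiener processes\<close>

text \<open>Set the process to \<open>0\<close> on a measurable null set outside which the paths are continuous, and
  extend the paths constantly to negative times. The result is the pointwise limit of the processes
  that are frozen at the grid points \<open>\<lfloor>n s\<rfloor> / n\<close>; these are jointly measurable because only countably
  many times occur.\<close>
lemma continuous_modification:
  fixes W :: "real \<Rightarrow> 'a \<Rightarrow> real"
  assumes meas: "\<And>s. 0 \<le> s \<Longrightarrow> W s \<in> borel_measurable M"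
    and cont: "AE \<omega> in M. continuous_on {0..} (\<lambda>s. W s \<omega>)"
  obtains P where "(\<lambda>(s, \<omega>). P s \<omega>) \<in> borel_measurable (borel \<Otimes>\<^sub>M M)"
    and "\<And>\<omega>. continuous_on UNIV (\<lambda>s. P s \<omega>)"
    and "AE \<omega> in M. \<forall>s\<ge>0. P s \<omega> = W s \<omega>"
proof -
  obtain N where N: "\<And>\<omega>. \<omega> \<in> space M - N \<Longrightarrow> continuous_on {0..} (\<lambda>s. W s \<omega>)" and null: "N \<in> null_sets M"
    using AE_E3[OF cont] by blast
  define P where "P s \<omega> = (if \<omega> \<in> space M - N then W (max 0 s) \<omega> else 0)" for s \<omega>
  have [measurable]: "N \<in> sets M"
    using null by auto
  have P_meas [measurable]: "P s \<in> borel_measurable M" for s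
    unfolding P_def using meas[of "max 0 s"] by measurable
  have P_cont: "continuous_on UNIV (\<lambda>s. P s \<omega>)" for \<omega>
  proof (cases "\<omega> \<in> space M - N")
    case True
    have "continuous_on UNIV (\<lambda>s. W (max 0 s) \<omega>)"
      by (rule continuous_on_compose2[OF N[OF True], of UNIV "\<lambda>s. max 0 s"])
        (auto intro!: continuous_intros)
    then show ?thesis
      using True by (simp add: P_def)
  next
    case False
    then have "P s \<omega> = 0" for s
      by (auto simp: P_def)
    then show ?thesis
      by simp
  qed
  have "(\<lambda>(s, \<omega>). P s \<omega>) \<in> borel_measurable (borel \<Otimes>\<^sub>M M)"
  proof (rule borel_measurable_LIMSEQ_real)
    fix n :: nat
    show "(\<lambda>x. P (real_of_int \<lfloor>fst x * real (Suc n)\<rfloor> / real (Suc n)) (snd x)) \<in> borel_measurable (borel \<Otimes>\<^sub>M M)"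
      by (rule measurable_compose_countable[where f="\<lambda>i x. P (real_of_int i / real (Suc n)) (snd x)"])
        measurable
  next
    fix x :: "real \<times> 'a"
    have lim: "(\<lambda>n. real_of_int \<lfloor>s * real (Suc n)\<rfloor> / real (Suc n)) \<longlonglongrightarrow> s" for s :: real
    proof (rule tendsto_sandwich)
      show "\<forall>\<^sub>F n in sequentially. s - 1 / real (Suc n) \<le> real_of_int \<lfloor>s * real (Suc n)\<rfloor> / real (Suc n)"
      proof (rule always_eventually, rule allI)
        fix n
        have "s * real (Suc n) - 1 \<le> real_of_int \<lfloor>s * real (Suc n)\<rfloor>"
          by linarith
        then have "(s * real (Suc n) - 1) / real (Suc n) \<le> real_of_int \<lfloor>s * real (Suc n)\<rfloor> / real (Suc n)"
          by (rule divide_right_mono) simp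
        then show "s - 1 / real (Suc n) \<le> real_of_int \<lfloor>s * real (Suc n)\<rfloor> / real (Suc n)"
          by (simp add: diff_divide_distrib)
      qed
      show "\<forall>\<^sub>F n in sequentially. real_of_int \<lfloor>s * real (Suc n)\<rfloor> / real (Suc n) \<le> s"
      proof (rule always_eventually, rule allI)
        fix n
        have "real_of_int \<lfloor>s * real (Suc n)\<rfloor> / real (Suc n) \<le> (s * real (Suc n)) / real (Suc n)"
          by (rule divide_right_mono) linarith+
        then show "real_of_int \<lfloor>s * real (Suc n)\<rfloor> / real (Suc n) \<le> s"
          by simp
      qed
      show "(\<lambda>n. s - 1 / real (Suc n)) \<longlonglongrightarrow> s"
        using tendsto_diff[OF tendsto_const[of s] lim_1_over_n[THEN LIMSEQ_Suc]] by simp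
    qed simp
    have "(\<lambda>n. P (real_of_int \<lfloor>fst x * real (Suc n)\<rfloor> / real (Suc n)) (snd x)) \<longlonglongrightarrow> P (fst x) (snd x)"
      by (rule continuous_on_tendsto_compose[OF P_cont lim]) auto
    then show "(\<lambda>n. P (real_of_int \<lfloor>fst x * real (Suc n)\<rfloor> / real (Suc n)) (snd x)) \<longlonglongrightarrow> (case x of (s, \<omega>) \<Rightarrow> P s \<omega>)"
      by (simp add: split_beta)
  qed
  moreover have "AE \<omega> in M. \<forall>s\<ge>0. P s \<omega> = W s \<omega>"
    using AE_not_in[OF null] AE_space by eventually_elim (auto simp: P_def)
  ultimately show thesis
    using P_cont that by blast
qed

lemma wiener_increment_moments:
  assumes W: "wiener_process W" and st: "0 \<le> s" "s \<le> t"
  shows "square_integrable (\<lambda>\<omega>. W t \<omega> - W s \<omega>)"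
    and "expectation (\<lambda>\<omega>. W t \<omega> - W s \<omega>) = 0"
    and "expectation (\<lambda>\<omega>. (W t \<omega> - W s \<omega>)\<^sup>2) = t - s"
proof -
  let ?X = "\<lambda>\<omega>. W t \<omega> - W s \<omega>"
  have "square_integrable ?X \<and> expectation ?X = 0 \<and> expectation (\<lambda>\<omega>. (?X \<omega>)\<^sup>2) = t - s"
  \<comment> \<open>The zero increment has no density and is treated separately.\<close>
  proof (cases "s = t")
    case True
    then show ?thesis
      by (simp add: square_integrable_const)
  next
    case False
    then have lt: "0 < sqrt (t - s)"
      using st by simp
    have D: "distributed M lborel ?X (normal_density 0 (sqrt (t - s)))"
      using W st False by (auto simp: wiener_process_def)
    have meas: "?X \<in> borel_measurable M"
      using D by (auto simp: distributed_def)
    have int: "integrable M (\<lambda>\<omega>. (?X \<omega>)\<^sup>2)"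
      using distributed_integrable[OF D, of "\<lambda>x. x\<^sup>2"] integrable_normal_moment[OF lt, of 0 2]
      by simp
    have mean: "expectation ?X = 0"
      using normal_distributed_expectation[OF lt D] .
    have "variance ?X = (sqrt (t - s))\<^sup>2"
      using normal_distributed_variance[OF lt D] .
    then show ?thesis
      using meas int mean st by (simp add: square_integrable_def)
  qed
  then show "square_integrable ?X" "expectation ?X = 0" "expectation (\<lambda>\<omega>. (?X \<omega>)\<^sup>2) = t - s"
    by auto
qed

text \<open>By polarization the variances of the increments suffice:
  \<open>2 A B = A\<^sup>2 + B\<^sup>2 - (B - A)\<^sup>2\<close> with the increments \<open>A\<close> up to \<open>s\<close> and \<open>B\<close> up to \<open>r\<close>.\<close>
lemma wiener_covariance:
  assumes W: "wiener_process W" and s: "0 \<le> s" and r: "0 \<le> r"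
  shows "expectation (\<lambda>\<omega>. (W s \<omega> - W 0 \<omega>) * (W r \<omega> - W 0 \<omega>)) = min s r"
proof -
  have *: "expectation (\<lambda>\<omega>. (W s \<omega> - W 0 \<omega>) * (W r \<omega> - W 0 \<omega>)) = s" if s: "0 \<le> s" and sr: "s \<le> r" for s r
  proof -
    let ?A = "\<lambda>\<omega>. W s \<omega> - W 0 \<omega>" and ?B = "\<lambda>\<omega>. W r \<omega> - W 0 \<omega>" and ?C = "\<lambda>\<omega>. W r \<omega> - W s \<omega>"
    have r: "0 \<le> r"
      using s sr by simp
    note A = wiener_increment_moments[OF W order_refl s]
    note B = wiener_increment_moments[OF W order_refl r]
    note C = wiener_increment_moments[OF W s sr]
    have "(\<lambda>\<omega>. ?A \<omega> * ?B \<omega>) = (\<lambda>\<omega>. ((?A \<omega>)\<^sup>2 + (?B \<omega>)\<^sup>2 - (?C \<omega>)\<^sup>2) / 2)"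
      by (simp add: power2_eq_square fun_eq_iff algebra_simps)
    then have "expectation (\<lambda>\<omega>. ?A \<omega> * ?B \<omega>) =
        expectation (\<lambda>\<omega>. ((?A \<omega>)\<^sup>2 + (?B \<omega>)\<^sup>2 - (?C \<omega>)\<^sup>2) / 2)"
      by simp
    also have "\<dots> = (s + r - (r - s)) / 2"
      using A B C by (simp add: square_integrable_def)
    finally show ?thesis
      by simp
  qed
  show ?thesis
    using *[OF s, of r] *[OF r, of s] by (cases "s \<le> r") (auto simp: mult.commute)
qed

lemma vector_wiener_covariance:
  fixes b :: "real \<Rightarrow> 'a \<Rightarrow> real^'n"
  assumes b: "vector_wiener_process b" and s: "0 \<le> s" and r: "0 \<le> r"
  shows "expectation (\<lambda>\<omega>. (b s \<omega> $ i - b 0 \<omega> $ i) * (b r \<omega> $ j - b 0 \<omega> $ j)) =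
    (if i = j then min s r else 0)"
proof (cases "i = j")
  case True
  then show ?thesis
    using b wiener_covariance[OF _ s r, of "\<lambda>t \<omega>. b t \<omega> $ i"] by (simp add: vector_wiener_process_def)
next
  case False
  have W: "wiener_process (\<lambda>t \<omega>. b t \<omega> $ k)" for k
    using b by (simp add: vector_wiener_process_def)
  \<comment> \<open>The variable \<open>b\<^sub>k(u k) - b\<^sub>k(0)\<close> is a function of the path of the component \<open>k\<close> alone; for
    \<open>k = i\<close> and \<open>k = j\<close> it is the increment in question.\<close>
  define u where "u k = (if k = i then s else r)" for k
  have u: "0 \<le> u k" for k
    using s r by (simp add: u_def)
  have "indep_vars (\<lambda>_. Pi\<^sub>M {0..} (\<lambda>_. borel)) (\<lambda>k \<omega>. \<lambda>t\<in>{0..}. b t \<omega> $ k) UNIV"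
    using b by (simp add: vector_wiener_process_def)
  then have "indep_vars (\<lambda>_. borel) (\<lambda>k \<omega>. (\<lambda>t\<in>{0..}. b t \<omega> $ k) (u k) - (\<lambda>t\<in>{0..}. b t \<omega> $ k) 0) UNIV"
    by (rule indep_vars_compose2[where Y="\<lambda>k p. p (u k) - p 0"])
      (intro borel_measurable_diff measurable_component_singleton; simp add: u)
  then have "indep_vars (\<lambda>_. borel) (\<lambda>k \<omega>. b (u k) \<omega> $ k - b 0 \<omega> $ k) UNIV"
    by (simp add: u)
  then have "indep_vars (\<lambda>_. borel) (\<lambda>k \<omega>. b (u k) \<omega> $ k - b 0 \<omega> $ k) {i, j}"
    by (rule indep_vars_subset) simp
  then have "expectation (\<lambda>\<omega>. \<Prod>k\<in>{i, j}. b (u k) \<omega> $ k - b 0 \<omega> $ k) =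
      (\<Prod>k\<in>{i, j}. expectation (\<lambda>\<omega>. b (u k) \<omega> $ k - b 0 \<omega> $ k))"
    by (intro indep_vars_lebesgue_integral)
      (auto intro!: square_integrable_integrable wiener_increment_moments(1)[OF W] u)
  also have "\<dots> = 0"
    using False wiener_increment_moments(2)[OF W order_refl u] by simp
  finally show ?thesis
    using False by (simp add: u_def)
qed

text \<open>Rotation invariance at the level of covariances: the coordinates of Brownian motion in an
  orthonormal basis again have covariance \<open>min s r\<close> and are mutually uncorrelated. They are replaced
  by versions for which Fubini's theorem is available.\<close>
lemma uncorrelated_wiener_modes:
  fixes b :: "real \<Rightarrow> 'a \<Rightarrow> real^'n" and \<xi> :: "'n \<Rightarrow> real^'n"
  assumes b: "vector_wiener_process b"
    and on: "\<And>i j. \<xi> i \<bullet> \<xi> j = (if i = j then 1 else 0)"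
  obtains P where "\<And>k t. square_integrable_process t (P k)"
    and "\<And>k s. 0 \<le> s \<Longrightarrow> expectation (P k s) = 0"
    and "\<And>k l s r. 0 \<le> s \<Longrightarrow> 0 \<le> r \<Longrightarrow>
      expectation (\<lambda>\<omega>. P k s \<omega> * P l r \<omega>) = (if k = l then 1 else 0) * min s r"
    and "AE \<omega> in M. \<forall>k. \<forall>s\<ge>0. P k s \<omega> = (b s \<omega> - b 0 \<omega>) \<bullet> \<xi> k"
proof -
  define X where "X i s \<omega> = b s \<omega> $ i - b 0 \<omega> $ i" for i s \<omega>
  define W where "W k s \<omega> = (\<Sum>i\<in>UNIV. \<xi> k $ i * X i s \<omega>)" for k s \<omega>
  have W_eq: "W k s \<omega> = (b s \<omega> - b 0 \<omega>) \<bullet> \<xi> k" for k s \<omega>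
    by (simp add: W_def X_def inner_vec_def mult.commute)
  have bw: "wiener_process (\<lambda>t \<omega>. b t \<omega> $ i)" for i
    using b by (simp add: vector_wiener_process_def)
  have X_L2: "square_integrable (X i s)" and X_mean: "expectation (X i s) = 0" if "0 \<le> s" for i s
    using wiener_increment_moments(1,2)[OF bw order_refl that, of i] by (simp_all add: X_def[abs_def])
  have X_cov: "expectation (\<lambda>\<omega>. X i s \<omega> * X j r \<omega>) = (if i = j then min s r else 0)"
    if "0 \<le> s" "0 \<le> r" for i j s r
    using vector_wiener_covariance[OF b that] by (simp add: X_def)
  have W_L2: "square_integrable (W k s)" if "0 \<le> s" for k s
    unfolding W_def by (intro square_integrable_sum square_integrable_cmult X_L2 that)
  have W_mean: "expectation (W k s) = 0" if "0 \<le> s" for k s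
  proof -
    have "integrable M (X i s)" for i
      by (intro square_integrable_integrable X_L2 that)
    then show ?thesis
      by (simp add: W_def[abs_def] X_mean[OF that])
  qed
  have W_cov: "expectation (\<lambda>\<omega>. W k s \<omega> * W l r \<omega>) = (if k = l then 1 else 0) * min s r"
    if "0 \<le> s" "0 \<le> r" for k l s r
  proof -
    have "integrable M (\<lambda>\<omega>. X i s \<omega> * X j r \<omega>)" for i j
      by (intro square_integrable_mult X_L2 that)
    moreover have "(\<lambda>\<omega>. W k s \<omega> * W l r \<omega>) =
        (\<lambda>\<omega>. \<Sum>i\<in>UNIV. \<Sum>j\<in>UNIV. (\<xi> k $ i * \<xi> l $ j) * (X i s \<omega> * X j r \<omega>))"
      by (simp add: W_def sum_product mult_ac)
    ultimately have "expectation (\<lambda>\<omega>. W k s \<omega> * W l r \<omega>) =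
        (\<Sum>i\<in>UNIV. \<Sum>j\<in>UNIV. (\<xi> k $ i * \<xi> l $ j) * (if i = j then min s r else 0))"
      by (simp add: X_cov[OF that])
    also have "\<dots> = (\<xi> k \<bullet> \<xi> l) * min s r"
      by (simp add: inner_vec_def sum_distrib_right if_distrib cong: if_cong)
    finally show ?thesis
      by (simp add: on)
  qed
  have "\<exists>P. (\<lambda>(s, \<omega>). P s \<omega>) \<in> borel_measurable (borel \<Otimes>\<^sub>M M) \<and>
      (\<forall>\<omega>. continuous_on UNIV (\<lambda>s. P s \<omega>)) \<and> (AE \<omega> in M. \<forall>s\<ge>0. P s \<omega> = W k s \<omega>)" for k
  proof -
    have "AE \<omega> in M. \<forall>i. continuous_on {0..} (\<lambda>t. b t \<omega> $ i)"
      using bw by (simp add: AE_all_countable wiener_process_def)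
    then have "AE \<omega> in M. continuous_on {0..} (\<lambda>s. W k s \<omega>)"
      by eventually_elim
        (auto simp: W_def X_def intro!: continuous_on_sum continuous_on_mult continuous_on_diff continuous_on_const)
    with W_L2 show ?thesis
      by (elim continuous_modification[of "W k", rotated]) (blast intro: square_integrable_measurable)+
  qed
  then have "\<forall>k. \<exists>P. (\<lambda>(s, \<omega>). P s \<omega>) \<in> borel_measurable (borel \<Otimes>\<^sub>M M) \<and>
      (\<forall>\<omega>. continuous_on UNIV (\<lambda>s. P s \<omega>)) \<and> (AE \<omega> in M. \<forall>s\<ge>0. P s \<omega> = W k s \<omega>)"
    by blast
  then obtain P where P_meas: "\<And>k. (\<lambda>(s, \<omega>). P k s \<omega>) \<in> borel_measurable (borel \<Otimes>\<^sub>M M)"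
    and P_cont: "\<And>k \<omega>. continuous_on UNIV (\<lambda>s. P k s \<omega>)"
    and P_eq: "\<And>k. AE \<omega> in M. \<forall>s\<ge>0. P k s \<omega> = W k s \<omega>"
    unfolding choice_iff by blast
  have P_meas1 [measurable]: "P k s \<in> borel_measurable M" for k s
    using measurable_compose[OF measurable_Pair1' P_meas, of s k] by simp
  have W_meas [measurable]: "W k s \<in> borel_measurable M" if "0 \<le> s" for k s
    using W_L2[OF that] by measurable
  have P_eq1: "AE \<omega> in M. P k s \<omega> = W k s \<omega>" if "0 \<le> s" for k s
    using P_eq[of k] by eventually_elim (use that in auto)
  have P_L2: "square_integrable (P k s)" if "0 \<le> s" for k s
    by (rule square_integrable_cong_AE[OF W_L2[OF that] P_meas1 P_eq1[OF that]])
  have P_cov: "expectation (\<lambda>\<omega>. P k s \<omega> * P l r \<omega>) = (if k = l then 1 else 0) * min s r"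
    if s: "0 \<le> s" and r: "0 \<le> r" for k l s r
  proof -
    note [measurable] = W_meas[OF s] W_meas[OF r]
    have "expectation (\<lambda>\<omega>. P k s \<omega> * P l r \<omega>) = expectation (\<lambda>\<omega>. W k s \<omega> * W l r \<omega>)"
    proof (rule integral_cong_AE)
      show "AE \<omega> in M. P k s \<omega> * P l r \<omega> = W k s \<omega> * W l r \<omega>"
        using P_eq1[OF s, of k] P_eq1[OF r, of l] by eventually_elim simp
    qed measurable
    then show ?thesis
      by (simp add: W_cov[OF s r])
  qed
  show thesis
  proof
    show "square_integrable_process t (P k)" for k t
      unfolding square_integrable_process_def
    proof (intro conjI P_meas allI ballI exI[of _ t])
      show "continuous_on {0..t} (\<lambda>s. P k s \<omega>)" for \<omega>
        using P_cont by (rule continuous_on_subset) simp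
      fix s assume s: "s \<in> {0..t}"
      show "square_integrable (P k s)"
        using s by (intro P_L2) simp
      show "expectation (\<lambda>\<omega>. (P k s \<omega>)\<^sup>2) \<le> t"
        using P_cov[of s s k k] s by (simp add: power2_eq_square)
    qed
    show "expectation (P k s) = 0" if "0 \<le> s" for k s
      using integral_cong_AE[OF P_meas1 W_meas[OF that] P_eq1[OF that], of k] W_mean[OF that] by simp
    show "AE \<omega> in M. \<forall>k. \<forall>s\<ge>0. P k s \<omega> = (b s \<omega> - b 0 \<omega>) \<bullet> \<xi> k"
      using P_eq by (simp add: AE_all_countable W_eq)
  qed (rule P_cov)
qed

section \<open>The linear equation with additive noise\<close>

lemma moments_of_uncorrelated_expansion:
  fixes X :: "'a \<Rightarrow> real^'n" and \<xi> :: "'n \<Rightarrow> real^'n"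
  assumes meas: "X \<in> borel_measurable M"
    and L2: "\<And>k. square_integrable (\<eta> k)"
    and mean: "\<And>k. expectation (\<eta> k) = 0"
    and cov: "\<And>k l. expectation (\<lambda>\<omega>. \<eta> k \<omega> * \<eta> l \<omega>) = (if k = l then v k else 0)"
    and X: "AE \<omega> in M. \<forall>i. X \<omega> $ i = m $ i + (\<Sum>k\<in>UNIV. \<xi> k $ i * \<eta> k \<omega>)"
  shows "has_second_moments X" and "mean_vector X = m"
    and "covariance_matrix X =
      matrix_of_columns \<xi> ** diag_matrix v ** transpose (matrix_of_columns \<xi>)"
proof -
  define S where "S i \<omega> = (\<Sum>k\<in>UNIV. \<xi> k $ i * \<eta> k \<omega>)" for i \<omega>
  have Xi_meas [measurable]: "(\<lambda>\<omega>. X \<omega> $ i) \<in> borel_measurable M" for i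
    using borel_measurable_inner[OF meas borel_measurable_const[of "axis i 1"]]
    by (simp add: inner_axis)
  have \<eta>_meas [measurable]: "\<eta> k \<in> borel_measurable M" for k
    using L2[of k] by measurable
  have S_L2: "square_integrable (S i)" for i
    unfolding S_def[abs_def] by (intro square_integrable_sum square_integrable_cmult L2)
  have S_meas [measurable]: "S i \<in> borel_measurable M" for i
    using S_L2[of i] by measurable
  have X_eq: "AE \<omega> in M. X \<omega> $ i = m $ i + S i \<omega>" for i
    using X by eventually_elim (simp add: S_def)
  have X_L2: "square_integrable (\<lambda>\<omega>. X \<omega> $ i)" for i
    by (rule square_integrable_cong_AE[OF square_integrable_add[OF square_integrable_const S_L2] Xi_meas X_eq])
  then show "has_second_moments X"
    using square_integrable_integrable[OF X_L2] by (simp add: has_second_moments_def square_integrable_def)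
  have S_mean: "expectation (S i) = 0" for i
    by (simp add: S_def[abs_def] square_integrable_integrable[OF L2] mean)
  have "expectation (\<lambda>\<omega>. X \<omega> $ i) = m $ i" for i
  proof -
    have "expectation (\<lambda>\<omega>. X \<omega> $ i) = expectation (\<lambda>\<omega>. m $ i + S i \<omega>)"
      by (rule integral_cong_AE[OF _ _ X_eq]) measurable
    also have "\<dots> = m $ i"
      using square_integrable_integrable[OF S_L2] by (simp add: S_mean prob_space)
    finally show ?thesis .
  qed
  then show mean_X: "mean_vector X = m"
    by (simp add: mean_vector_def vec_eq_iff)
  have "covariance_matrix X $ i $ j =
      (matrix_of_columns \<xi> ** diag_matrix v ** transpose (matrix_of_columns \<xi>)) $ i $ j" for i j
  proof -
    have "covariance_matrix X $ i $ j = expectation (\<lambda>\<omega>. (X \<omega> $ i - m $ i) * (X \<omega> $ j - m $ j))"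
      by (simp add: covariance_matrix_def mean_X)
    also have "\<dots> = expectation (\<lambda>\<omega>. S i \<omega> * S j \<omega>)"
    proof (rule integral_cong_AE)
      show "AE \<omega> in M. (X \<omega> $ i - m $ i) * (X \<omega> $ j - m $ j) = S i \<omega> * S j \<omega>"
        using X_eq[of i] X_eq[of j] by eventually_elim simp
    qed measurable
    also have "\<dots> = expectation (\<lambda>\<omega>. \<Sum>k\<in>UNIV. \<Sum>l\<in>UNIV. (\<xi> k $ i * \<xi> l $ j) * (\<eta> k \<omega> * \<eta> l \<omega>))"
      by (simp add: S_def sum_product mult_ac)
    also have "\<dots> = (\<Sum>k\<in>UNIV. \<Sum>l\<in>UNIV. (\<xi> k $ i * \<xi> l $ j) * (if k = l then v k else 0))"
      by (simp add: square_integrable_mult[OF L2 L2] cov)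
    also have "\<dots> = (\<Sum>k\<in>UNIV. v k * (\<xi> k $ i * \<xi> k $ j))"
      by (simp add: if_distrib mult_ac cong: if_cong)
    finally show ?thesis
      by (simp add: columns_diag_transpose_nth)
  qed
  then show "covariance_matrix X =
      matrix_of_columns \<xi> ** diag_matrix v ** transpose (matrix_of_columns \<xi>)"
    by (simp add: vec_eq_iff)
qed

text \<open>Because \<open>A\<close> is symmetric, the projection of the equation on an eigenvector involves only
  the projection of the solution: along each path it is a scalar integral equation. Variation of
  constants solves it, and the noise enters through the integral of the exponential kernel.\<close>
lemma linear_sde_mode:
  fixes A :: "real^'n^'n"
  assumes x: "solves_additive_noise_sde (\<lambda>y. - (A *v y)) a b c x"
    and A: "transpose A = A" and ev: "A *v v = l *\<^sub>R v" and t: "0 \<le> t"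
    and B: "AE \<omega> in M. \<forall>s\<ge>0. B s \<omega> = (b s \<omega> - b 0 \<omega>) \<bullet> v"
    and B_cont: "\<And>\<omega>. continuous_on {0..t} (\<lambda>s. B s \<omega>)"
  shows "AE \<omega> in M. x t \<omega> \<bullet> v = exp (- (l * t)) * (c \<bullet> v) +
    a * wiener_integral (\<lambda>s. exp (- (l * (t - s)))) (\<lambda>s. l * exp (- (l * (t - s)))) t (\<lambda>s. B s \<omega>)"
proof -
  have cont: "AE \<omega> in M. continuous_on {0..} (\<lambda>t. x t \<omega>)"
    and eq: "AE \<omega> in M. \<forall>t\<ge>0. (\<lambda>s. - (A *v x s \<omega>)) integrable_on {0..t} \<and>
        x t \<omega> = c + integral {0..t} (\<lambda>s. - (A *v x s \<omega>)) + a *\<^sub>R (b t \<omega> - b 0 \<omega>)"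
    using x by (simp_all add: solves_additive_noise_sde_def)
  have A_inner: "(A *v y) \<bullet> v = l * (y \<bullet> v)" for y
    using dot_lmul_matrix[of y A v] transpose_matrix_vector[of A y] by (simp add: A ev)
  from cont eq B show ?thesis
  proof eventually_elim
    case (elim \<omega>)
    let ?y = "\<lambda>s. x s \<omega> \<bullet> v"
    have y_cont: "continuous_on {0..t} ?y"
      by (intro continuous_intros continuous_on_subset[OF elim(1)]) auto
    have "?y s = c \<bullet> v - l * integral {0..s} ?y + a * B s \<omega>" if s: "s \<in> {0..t}" for s
    proof -
      have int: "(\<lambda>s. - (A *v x s \<omega>)) integrable_on {0..s}"
        and xs: "x s \<omega> = c + integral {0..s} (\<lambda>s. - (A *v x s \<omega>)) + a *\<^sub>R (b s \<omega> - b 0 \<omega>)"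
        using elim(2) s by auto
      have "integral {0..s} (\<lambda>s. - (A *v x s \<omega>)) \<bullet> v = integral {0..s} (\<lambda>s. (- (A *v x s \<omega>)) \<bullet> v)"
        using integral_linear[OF int bounded_linear_inner_left[of v]] by (simp add: o_def)
      also have "\<dots> = - l * integral {0..s} ?y"
        by (simp add: A_inner)
      finally have i: "integral {0..s} (\<lambda>s. - (A *v x s \<omega>)) \<bullet> v = - l * integral {0..s} ?y" .
      have "?y s = c \<bullet> v + integral {0..s} (\<lambda>s. - (A *v x s \<omega>)) \<bullet> v + a * ((b s \<omega> - b 0 \<omega>) \<bullet> v)"
        by (subst xs) (simp add: inner_add_left inner_diff_left)
      then show ?thesis
        using i elim(3) s by simp
    qed
    from linear_integral_equation_solution[OF t y_cont B_cont this] show ?case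
      by (simp add: wiener_integral_def)
  qed
qed

end

theorem theorem1:
  fixes M :: "'a measure"
    and E :: "('n \<times> 'n::{finite,linorder}) set"
    and w :: "'n \<Rightarrow> 'n \<Rightarrow> real"
    and L U :: "((real, 'n) vec, 'n) vec"
    and lam \<theta> :: "'n \<Rightarrow> real"
    and \<xi> :: "'n \<Rightarrow> (real, 'n) vec"
    and c :: "(real, 'n) vec"
    and \<alpha> \<gamma> t :: real
    and b x e :: "real \<Rightarrow> 'a \<Rightarrow> (real, 'n) vec"
  assumes "sym E"
    and "\<And>i j. (i, j) \<in> E\<^sup>*"
    and "\<And>i j. (i, j) \<in> E \<Longrightarrow> 0 < w i j"
    and "\<And>i j. (i, j) \<in> E \<Longrightarrow> w i j = w j i"
  defines "L \<equiv> laplacian E w"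
  assumes "ordered_orthonormal_eigenbasis L lam \<xi>"
    and "\<xi> (Min UNIV) = (1 / sqrt (real CARD('n))) *\<^sub>R 1"
  defines "U \<equiv> matrix_of_columns \<xi>"
  assumes "prob_space M"
    and "prob_space.vector_wiener_process M b"
    and "0 < \<alpha>"
    and "prob_space.solves_additive_noise_sde M (\<lambda>y. - (L *v y)) \<alpha> b c x"
  defines "\<gamma> \<equiv> (1 / real CARD('n)) * (\<Sum>i\<in>UNIV. c $ i)"
    and "e \<equiv> \<lambda>s \<omega>. x s \<omega> - \<gamma> *\<^sub>R 1"
    and "\<theta> \<equiv> \<lambda>i. \<alpha>\<^sup>2 / (2 * lam i) * (1 - exp (- 2 * lam i * t))"
  assumes "0 < t"
  shows "prob_space.has_second_moments M (e t) \<and>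
         prob_space.mean_vector M (e t) = matrix_exp (- (t *\<^sub>R L)) *v (c - \<gamma> *\<^sub>R 1) \<and>
         prob_space.covariance_matrix M (e t) =
           U ** diag_matrix (\<lambda>i. if i = Min UNIV then \<alpha>\<^sup>2 * t else \<theta> i) ** transpose U"
proof -
  interpret prob_space M by fact
  have ev: "\<And>k. L *v \<xi> k = lam k *\<^sub>R \<xi> k"
    and on: "\<And>i j. \<xi> i \<bullet> \<xi> j = (if i = j then 1 else 0)"
    using assms by (auto simp: ordered_orthonormal_eigenbasis_def)
  have L_sym: "transpose L = L"
    unfolding L_def using assms(1,4) by (rule laplacian_symmetric)
  have lam_0: "lam k = 0 \<longleftrightarrow> k = Min UNIV" for k
    by (rule laplacian_eigenvalue_eq_0_iff[OF assms(1-4) on ev[unfolded L_def] assms(7)])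
  have t: "0 \<le> t"
    using \<open>0 < t\<close> by simp
  obtain P where P: "\<And>k t. square_integrable_process t (P k)"
    and P_mean: "\<And>k s. 0 \<le> s \<Longrightarrow> expectation (P k s) = 0"
    and P_cov: "\<And>k l s r. 0 \<le> s \<Longrightarrow> 0 \<le> r \<Longrightarrow>
      expectation (\<lambda>\<omega>. P k s \<omega> * P l r \<omega>) = (if k = l then 1 else 0) * min s r"
    and P_eq: "AE \<omega> in M. \<forall>k. \<forall>s\<ge>0. P k s \<omega> = (b s \<omega> - b 0 \<omega>) \<bullet> \<xi> k"
    using uncorrelated_wiener_modes[OF \<open>vector_wiener_process b\<close> on] by blast
  define f where "f k s = exp (- (lam k * (t - s)))" for k s
  define f' where "f' k s = lam k * exp (- (lam k * (t - s)))" for k s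
  have f: "(f k has_real_derivative f' k s) (at s within {0..t})" for k s
    unfolding f_def[abs_def] f'_def by (auto intro!: derivative_eq_intros)
  have f': "continuous_on {0..t} (f' k)" for k
    unfolding f'_def[abs_def] by (intro continuous_intros)
  define \<eta> where "\<eta> k \<omega> = \<alpha> * wiener_integral (f k) (f' k) t (\<lambda>s. P k s \<omega>)" for k \<omega>
  have \<eta>_L2: "square_integrable (\<eta> k)" for k
    unfolding \<eta>_def[abs_def]
    by (intro square_integrable_cmult square_integrable_wiener_integral t P f')
  have \<eta>_mean: "expectation (\<eta> k) = 0" for k
    using expectation_wiener_integral[OF t P f', of k] P_mean by (simp add: \<eta>_def[abs_def])
  have \<eta>_cov: "expectation (\<lambda>\<omega>. \<eta> k \<omega> * \<eta> l \<omega>) =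
      (if k = l then if k = Min UNIV then \<alpha>\<^sup>2 * t else \<theta> k else 0)" for k l
  proof -
    have "expectation (\<lambda>\<omega>. wiener_integral (f k) (f' k) t (\<lambda>s. P k s \<omega>) *
        wiener_integral (f l) (f' l) t (\<lambda>s. P l s \<omega>)) =
        (if k = l then 1 else 0) * integral {0..t} (\<lambda>s. f k s * f l s)"
      using P_cov by (intro ito_isometry t P f f') auto
    moreover have "(\<lambda>\<omega>. \<eta> k \<omega> * \<eta> l \<omega>) = (\<lambda>\<omega>. \<alpha>\<^sup>2 * (wiener_integral (f k) (f' k) t (\<lambda>s. P k s \<omega>) *
        wiener_integral (f l) (f' l) t (\<lambda>s. P l s \<omega>)))"
      by (simp add: \<eta>_def power2_eq_square mult_ac)
    ultimately have "expectation (\<lambda>\<omega>. \<eta> k \<omega> * \<eta> l \<omega>) =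
        (if k = l then \<alpha>\<^sup>2 * integral {0..t} (\<lambda>s. f k s * f k s) else 0)"
      by simp
    moreover have "\<alpha>\<^sup>2 * integral {0..t} (\<lambda>s. f k s * f k s) =
        (if k = Min UNIV then \<alpha>\<^sup>2 * t else \<theta> k)"
    proof (cases "k = Min UNIV")
      case True
      then have "lam k = 0"
        by (simp add: lam_0)
      then show ?thesis
        using True t by (simp add: f_def)
    next
      case False
      then have "lam k \<noteq> 0"
        by (simp add: lam_0)
      then show ?thesis
        using False integral_squared_exponential[of "lam k" t] t by (simp add: f_def \<theta>_def)
    qed
    ultimately show ?thesis
      by (simp only:)
  qed
  \<comment> \<open>The average is carried by the mode with eigenvalue \<open>0\<close>, which does not decay; subtracting it
    from the solution therefore amounts to subtracting it from the initial value.\<close>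
  have one: "1 \<bullet> \<xi> k = 0" if "lam k \<noteq> 0" for k
  proof -
    have "\<xi> (Min UNIV) \<bullet> \<xi> k = 0"
      using on[of "Min UNIV" k] that lam_0[of k] by auto
    then show ?thesis
      using assms(7) by simp
  qed
  have e_meas: "e t \<in> borel_measurable M"
    unfolding e_def using assms(12) t
    by (intro borel_measurable_diff borel_measurable_const) (simp add: solves_additive_noise_sde_def)
  have P_cont: "continuous_on {0..t} (\<lambda>s. P k s \<omega>)" for k \<omega>
    using P[of t k] by (simp add: square_integrable_process_def)
  let ?m = "matrix_exp (- (t *\<^sub>R L)) *v (c - \<gamma> *\<^sub>R 1)"
  have m: "?m $ i = (\<Sum>k\<in>UNIV. exp (- (lam k * t)) * ((c - \<gamma> *\<^sub>R 1) \<bullet> \<xi> k) * \<xi> k $ i)" for i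
  proof (rule matrix_exp_mult_eigenbasis[OF on])
    have "((- t) *\<^sub>R L) *v \<xi> k = (- (lam k * t)) *\<^sub>R \<xi> k" for k
      unfolding scaleR_matrix_vector_assoc[symmetric] ev by (simp add: mult.commute)
    then show "(- (t *\<^sub>R L)) *v \<xi> k = (- (lam k * t)) *\<^sub>R \<xi> k" for k
      by simp
  qed
  have "AE \<omega> in M. \<forall>k. x t \<omega> \<bullet> \<xi> k = exp (- (lam k * t)) * (c \<bullet> \<xi> k) + \<eta> k \<omega>"
    unfolding AE_all_countable
  proof
    fix k
    have "AE \<omega> in M. \<forall>s\<ge>0. P k s \<omega> = (b s \<omega> - b 0 \<omega>) \<bullet> \<xi> k"
      using P_eq by eventually_elim simp
    from linear_sde_mode[OF assms(12) L_sym ev t this P_cont]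
    show "AE \<omega> in M. x t \<omega> \<bullet> \<xi> k = exp (- (lam k * t)) * (c \<bullet> \<xi> k) + \<eta> k \<omega>"
      by (simp add: \<eta>_def f_def[abs_def] f'_def[abs_def])
  qed
  then have e_eq: "AE \<omega> in M. \<forall>i. e t \<omega> $ i = ?m $ i + (\<Sum>k\<in>UNIV. \<xi> k $ i * \<eta> k \<omega>)"
  proof eventually_elim
    case (elim \<omega>)
    have mode: "e t \<omega> \<bullet> \<xi> k = exp (- (lam k * t)) * ((c - \<gamma> *\<^sub>R 1) \<bullet> \<xi> k) + \<eta> k \<omega>" for k
    proof (cases "lam k = 0")
      case True
      then show ?thesis
        using elim by (simp add: e_def inner_diff_left)
    next
      case False
      then show ?thesis
        using elim one[of k] by (simp add: e_def inner_diff_left)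
    qed
    show ?case
    proof
      fix i
      have "e t \<omega> $ i = (\<Sum>k\<in>UNIV. (e t \<omega> \<bullet> \<xi> k) * \<xi> k $ i)"
        by (rule orthonormal_expansion[OF on])
      also have "\<dots> = ?m $ i + (\<Sum>k\<in>UNIV. \<xi> k $ i * \<eta> k \<omega>)"
        unfolding m mode by (simp add: distrib_right sum.distrib) (simp add: mult.commute)
      finally show "e t \<omega> $ i = ?m $ i + (\<Sum>k\<in>UNIV. \<xi> k $ i * \<eta> k \<omega>)" .
    qed
  qed
  show ?thesis
    unfolding U_def
    using moments_of_uncorrelated_expansion[OF e_meas \<eta>_L2 \<eta>_mean \<eta>_cov e_eq] by blast
qed

end
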